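(* Let $\nu\in\mathbb N$ and let $F_\nu=\bigcup_{j=1}^\nu L_j\cup \{O\}\subset\mathbb R^3$ be a frame of $\nu$ arcs. Then $F_\nu$ is tame if and only if there is a homeomorphism $G:\mathbb R^3\setminus \{O\}\to\mathbb R^3\setminus \{O\}$ such that every leaf $G(\mathbb P_t)$, $t>0$, of the foliation $P=G(\mathbb P)$ intersects each arc $L_j$, $j\in\{1,\dots,\nu\}$, at a single point.
   Context: $O=(0,0,0)\in\mathbb R^3$, $\|x\|$ is the Euclidean norm, and $\mathbb S^2\subset\mathbb R^3$ is the unit sphere. For $x\in\mathbb R^3\setminus\{O\}$ put $q(x)=x/\|x\|\in\mathbb S^2$ and $r(x)=\log_2\|x\|\in\mathbb R$; the map $x\mapsto (q(x),r(x))$ identifies $\mathbb R^3\setminus\{O\}$ with $\mathbb S^2\times\mathbb R$. Open ray from $O$: a set $\mathbb L=\{x\in\mathbb R^3\setminus\{O\}: q(x)=s\}$ for some $s\in\mathbb S^2$. Infinite arc from $O$: a one-dimensional submanifold $L\subset\mathbb R^3\setminus\{O\}$ with $r(L)=\mathbb R$. Let $A:\mathbb R^3\to\mathbb R^3$, $A(x)=2x$. A frame of $\nu$ arcs is a set $F_\nu=\bigcup_{j=1}^{\nu}L_j\cup\{O\}$, where $L_1,\dots,L_\nu$ are pairwise disjoint infinite arcs from $O$, each invariant under $A$ (i.e. $A(L_j)=L_j$). A standard frame is a frame $\mathbb F_\nu=\bigcup_{j=1}^{\nu}\mathbb L_j\cup\{O\}$, where $\mathbb L_1,\dots,\mathbb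 L_\nu$ are pairwise distinct open rays from $O$. A frame $F_\nu$ is tame if there is a homeomorphism $H:\mathbb R^3\to\mathbb R^3$ with $F_\nu=H(\mathbb F_\nu)$ for a standard frame $\mathbb F_\nu$ of $\nu$ rays. $\mathbb P$ is the foliation of $\mathbb R^3\setminus\{O\}$ by the round spheres $\mathbb P_t=\{x\in\mathbb R^3:\|x\|=t\}$, $t>0$, and $G(\mathbb P)$ is the foliation with leaves $G(\mathbb P_t)$. *)

theory Defs
  imports "HOL-Analysis.Analysis"
begin

definition radial_dir :: "real^3 \<Rightarrow> real^3" where
  "radial_dir x = x /\<^sub>R norm x"

definition radial_log :: "real^3 \<Rightarrow> real" where
  "radial_log x = log 2 (norm x)"

definition doubling :: "real^3 \<Rightarrow> real^3" where
  "doubling x = 2 *\<^sub>R x"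

definition open_ray :: "(real^3) set \<Rightarrow> bool" where
  "open_ray R \<longleftrightarrow> (\<exists>s \<in> sphere 0 1. R = {x \<in> UNIV - {0}. radial_dir x = s})"

text \<open>
  Topological submanifolds without boundary, given by slice charts of the open
  set \<open>M\<close>.  Neither closedness in \<open>M\<close> nor connectedness is required.
\<close>
definition one_dim_submanifold :: "(real^3) set \<Rightarrow> (real^3) set \<Rightarrow> bool" where
  "one_dim_submanifold M L \<longleftrightarrow> L \<subseteq> M \<and>
     (\<forall>x\<in>L. \<exists>U V \<phi> \<psi>. openin (top_of_set M) U \<and> x \<in> U \<and> open V \<and>
        homeomorphism U V \<phi> \<psi> \<and> \<phi> ` (U \<inter> L) = V \<inter> {y :: real^3. y $ 2 = 0 \<and> y $ 3 = 0})"

definition infinite_arc :: "(real^3) set \<Rightarrow> bool" where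
  "infinite_arc L \<longleftrightarrow> one_dim_submanifold (UNIV - {0}) L \<and> radial_log ` L = UNIV"

definition arcs_of_frame :: "nat \<Rightarrow> (nat \<Rightarrow> (real^3) set) \<Rightarrow> bool" where
  "arcs_of_frame \<nu> L \<longleftrightarrow>
     (\<forall>j\<in>{1..\<nu>}. infinite_arc (L j) \<and> doubling ` L j = L j) \<and>
     disjoint_family_on L {1..\<nu>}"

definition frame :: "nat \<Rightarrow> (nat \<Rightarrow> (real^3) set) \<Rightarrow> (real^3) set" where
  "frame \<nu> L = (\<Union>j\<in>{1..\<nu>}. L j) \<union> {0}"

definition standard_frame :: "nat \<Rightarrow> (real^3) set \<Rightarrow> bool" where
  "standard_frame \<nu> S \<longleftrightarrow>
     (\<exists>R. arcs_of_frame \<nu> R \<and> (\<forall>j\<in>{1..\<nu>}. open_ray (R j)) \<and> inj_on R {1..\<nu>} \<and>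
          S = frame \<nu> R)"

definition tame_frame :: "nat \<Rightarrow> (real^3) set \<Rightarrow> bool" where
  "tame_frame \<nu> F \<longleftrightarrow>
     (\<exists>H H' S. homeomorphism UNIV UNIV H H' \<and> standard_frame \<nu> S \<and> F = H ` S)"

lemma open_ray_iff: "open_ray R \<longleftrightarrow> (\<exists>s. norm s = 1 \<and> R = {t *\<^sub>R s |t. t > 0})"
proof -
  have "{x \<in> UNIV - {0}. radial_dir x = s} = {t *\<^sub>R s |t. t > 0}" if "norm s = 1" for s
  proof (intro set_eqI iffI)
    fix x assume "x \<in> {x \<in> UNIV - {0}. radial_dir x = s}"
    then have "x \<noteq> 0" "s = x /\<^sub>R norm x"
      by (simp_all add: radial_dir_def)
    then show "x \<in> {t *\<^sub>R s |t. t > 0}"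
      by (intro CollectI exI[of _ "norm x"]) simp
  next
    fix x assume "x \<in> {t *\<^sub>R s |t. t > 0}"
    then show "x \<in> {x \<in> UNIV - {0}. radial_dir x = s}"
      using that by (auto simp: radial_dir_def)
  qed
  then show ?thesis
    by (auto simp: open_ray_def)
qed

lemma open_ray_infinite_arc:
  assumes "open_ray R"
  shows "infinite_arc R" "doubling ` R = R"
proof -
  obtain s where s: "norm s = 1" and R: "R = {t *\<^sub>R s |t. t > 0}"
    using assms by (auto simp: open_ray_iff)
  show "doubling ` R = R"
  proof (intro set_eqI iffI)
    fix x assume "x \<in> doubling ` R"
    then obtain t where "t > 0" "x = (2 * t) *\<^sub>R s" by (auto simp: R doubling_def)
    then show "x \<in> R" unfolding R by (intro CollectI exI[of _ "2 * t"]) simp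
  next
    fix x assume "x \<in> R"
    then obtain t where "t > 0" "x = doubling ((t / 2) *\<^sub>R s)"
      by (auto simp: R doubling_def)
    moreover have "(t / 2) *\<^sub>R s \<in> R" using \<open>t > 0\<close> unfolding R by (intro CollectI exI[of _ "t / 2"]) simp
    ultimately show "x \<in> doubling ` R" by (intro image_eqI)
  qed
  have log: "radial_log ` R = UNIV"
  proof -
    have "y \<in> radial_log ` R" for y
    proof
      show "(2 powr y) *\<^sub>R s \<in> R" by (auto simp: R)
      show "y = radial_log ((2 powr y) *\<^sub>R s)" using s by (simp add: radial_log_def)
    qed
    then show ?thesis by blast
  qed
  obtain f :: "real^3 \<Rightarrow> real^3" where f: "orthogonal_transformation f" "f s = axis 1 1"
    using orthogonal_transformation_exists[of s "axis 1 1 :: real^3"] s by auto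
  have lin: "linear f" and inj: "inj f" and surj: "surj f"
    by (fact orthogonal_transformation_linear[OF f(1)] orthogonal_transformation_inj[OF f(1)]
        orthogonal_transformation_surj[OF f(1)])+
  define U where "U = {x. x \<bullet> s > 0}"
  define V where "V = {y :: real^3. y $ 1 > 0}"
  have inner: "f x $ 1 = x \<bullet> s" for x
  proof -
    have "f x $ 1 = f x \<bullet> f s" by (simp add: f(2) inner_axis)
    then show ?thesis using f(1) by (simp add: orthogonal_transformation_def)
  qed
  have "continuous_on U f" "continuous_on V (inv f)"
    using lin orthogonal_transformation_linear[OF orthogonal_transformation_inv[OF f(1)]]
    by (simp_all add: linear_continuous_on linear_linear)
  moreover have "f ` U = V"
  proof (intro set_eqI iffI)
    fix y assume "y \<in> V"
    moreover obtain x where "y = f x" using surj by (auto simp: surj_def)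
    ultimately show "y \<in> f ` U" by (simp add: U_def V_def inner)
  qed (auto simp: U_def V_def inner)
  ultimately have hom: "homeomorphism U V f (inv f)"
    by (intro homeomorphismI) (auto simp: inj surj_f_inv_f[OF surj])
  have sl: "f ` (U \<inter> R) = V \<inter> {y :: real^3. y $ 2 = 0 \<and> y $ 3 = 0}"
  proof (intro set_eqI iffI)
    fix y assume "y \<in> f ` (U \<inter> R)"
    then obtain t where "t > 0" "y = f (t *\<^sub>R s)" by (auto simp: R)
    then show "y \<in> V \<inter> {y. y $ 2 = 0 \<and> y $ 3 = 0}"
      using lin f(2) by (simp add: linear_scale V_def axis_def)
  next
    fix y :: "real^3" assume y: "y \<in> V \<inter> {y. y $ 2 = 0 \<and> y $ 3 = 0}"
    have "f ((y $ 1) *\<^sub>R s) = (y $ 1) *\<^sub>R axis 1 1"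
      using lin f(2) by (simp add: linear_scale)
    also have "\<dots> = y"
      using y by (simp add: vec_eq_iff forall_3 axis_def)
    finally have "y = f ((y $ 1) *\<^sub>R s)" by (rule sym)
    moreover have "(y $ 1) *\<^sub>R s \<in> U \<inter> R"
      using y s by (auto simp: U_def V_def R dot_square_norm)
    ultimately show "y \<in> f ` (U \<inter> R)" by (rule image_eqI)
  qed
  have "open U" unfolding U_def using open_halfspace_gt[of 0 s] by (simp add: inner_commute)
  moreover have "U \<subseteq> UNIV - {0}" by (auto simp: U_def)
  ultimately have oU: "openin (top_of_set (UNIV - {0})) U"
    by (simp add: openin_open_eq open_delete)
  have oV: "open V" unfolding V_def by (rule open_halfspace_component_gt_cart)
  have "R \<subseteq> U" "R \<subseteq> UNIV - {0}" using s by (auto simp: R U_def dot_square_norm)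
  then have "one_dim_submanifold (UNIV - {0}) R"
    unfolding one_dim_submanifold_def using oU oV hom sl
    by (intro conjI ballI exI[of _ U] exI[of _ V] exI[of _ f] exI[of _ "inv f"]) auto
  with log show "infinite_arc R" by (simp add: infinite_arc_def)
qed

lemma open_rays_disjoint:
  assumes "open_ray R" "open_ray R'" "R \<noteq> R'"
  shows "R \<inter> R' = {}"
  using assms by (auto simp: open_ray_def)

lemma arcs_of_frame_open_rays:
  assumes "\<And>j. j \<in> {1..\<nu>} \<Longrightarrow> open_ray (R j)" "inj_on R {1..\<nu>}"
  shows "arcs_of_frame \<nu> R"
  unfolding arcs_of_frame_def disjoint_family_on_def
proof (intro conjI ballI impI)
  fix i j assume "i \<in> {1..\<nu>}" "j \<in> {1..\<nu>}" "i \<noteq> j"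
  then show "R i \<inter> R j = {}"
    using assms by (intro open_rays_disjoint) (auto dest: inj_onD)
qed (simp_all add: assms(1) open_ray_infinite_arc)

end

theory Submission imports Defs begin

text \<open>
  If the frame is \<open>H(S)\<close> for a standard frame \<open>S\<close>, one may assume \<open>H(O) = O\<close>: for
  \<open>\<nu> \<noteq> 2\<close> the apex of \<open>S\<close> is distinguished by the number of components of its
  complement in \<open>S\<close>, so \<open>H(O)\<close> is fixed by the doubling map; for \<open>\<nu> = 2\<close> the two rays
  form a bent line, along which \<open>\<real>\<^sup>3\<close> can be slid. By connectedness and
  invariance of domain in dimension one, every \<open>L\<^sub>j\<close> is then the image of a single
  ray, and \<open>G = H\<close> works.

  Conversely, composing \<open>G\<close> with the inversion \<open>x \<mapsto> x / \<parallel>x\<parallel>\<^sup>2\<close> if necessary, \<open>G\<close> fixes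
  the end \<open>O\<close> and extends to \<open>\<real>\<^sup>3\<close>. Invariance of domain shows that
  \<open>G\<^sup>-\<^sup>1(L\<^sub>j)\<close> is the graph of a continuous path \<open>m\<^sub>j\<close> in the sphere, parametrised by
  \<open>\<tau> = ln \<parallel>x\<parallel>\<close>. The paths \<open>m\<^sub>j\<close> never collide, so there is a continuous family of
  injections of the sphere carrying \<open>m\<^sub>j(0)\<close> to \<open>m\<^sub>j(\<tau>)\<close> for all \<open>j\<close> at once,
  composed from small pushes with disjoint supports; it straightens all the graphs
  to rays simultaneously.
\<close>

subsection \<open>Isotopies of the sphere\<close>

text \<open>Only injectivity is asked of each stage, so pushes and compositions are easy to check.
  Surjectivity and a continuous inverse come later, for the radial extension, from invariance of
  domain.\<close>

definition sphere_isotopy :: "(real \<Rightarrow> 'a::euclidean_space \<Rightarrow> 'a) \<Rightarrow> bool" where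
  "sphere_isotopy f \<longleftrightarrow> continuous_on (UNIV \<times> sphere 0 1) (\<lambda>(t, x). f t x) \<and>
     (\<forall>t. inj_on (f t) (sphere 0 1) \<and> f t \<in> sphere 0 1 \<rightarrow> sphere 0 1)"

lemma sphere_isotopy_id: "sphere_isotopy (\<lambda>t x. x)"
  by (auto simp: sphere_isotopy_def case_prod_unfold intro!: continuous_intros)

text \<open>The time change \<open>h\<close> allows one factor to run backwards:
  \<open>h t = - t\<close> serves negative times, \<open>h t = t\<close> the remaining uses.\<close>

lemma sphere_isotopy_compose:
  assumes f: "sphere_isotopy f" and g: "sphere_isotopy g" and h: "continuous_on UNIV h"
  shows "sphere_isotopy (\<lambda>t x. f t (g (h t) x))"
proof -
  have g': "continuous_on (UNIV \<times> sphere 0 1) (\<lambda>z. g (h (fst z)) (snd z))"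
    using g unfolding sphere_isotopy_def case_prod_unfold
    by (intro continuous_on_compose2[of "UNIV \<times> sphere 0 1" "\<lambda>z. g (fst z) (snd z)" _ "\<lambda>z. (h (fst z), snd z)", simplified]
        continuous_intros continuous_on_compose2[OF h]) auto
  have "continuous_on (UNIV \<times> sphere 0 1) (\<lambda>z. f (fst z) (g (h (fst z)) (snd z)))"
    using f g unfolding sphere_isotopy_def case_prod_unfold
    by (intro continuous_on_compose2[of "UNIV \<times> sphere 0 1" "\<lambda>z. f (fst z) (snd z)" _ "\<lambda>z. (fst z, g (h (fst z)) (snd z))", simplified]
        continuous_intros g') (auto simp: Pi_iff)
  moreover have "inj_on (\<lambda>x. f t (g (h t) x)) (sphere 0 1)" for t
    using f g unfolding sphere_isotopy_def inj_on_def Pi_iff by metis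
  ultimately show ?thesis
    using f g unfolding sphere_isotopy_def case_prod_unfold Pi_iff by metis
qed

text \<open>A tent function of height 1 and radius \<open>r\<close> about \<open>p\<close> drags
  \<open>p\<close> along the chord to \<open>q\<close>; \<open>sgn\<close> projects back to the
  sphere.\<close>

definition sphere_push :: "real \<Rightarrow> 'a::euclidean_space \<Rightarrow> 'a \<Rightarrow> 'a \<Rightarrow> 'a" where
  "sphere_push r p q x = sgn (x + max 0 (1 - dist x p / r) *\<^sub>R (q - p))"

lemma sphere_push_center: "norm q = 1 \<Longrightarrow> sphere_push r p q p = q"
  by (simp add: sphere_push_def sgn_div_norm)

lemma sphere_push_far: "norm x = 1 \<Longrightarrow> 0 < r \<Longrightarrow> r \<le> dist x p \<Longrightarrow> sphere_push r p q x = x"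
  by (simp add: sphere_push_def sgn_div_norm max_def field_simps)

lemma sphere_push_same: "norm x = 1 \<Longrightarrow> sphere_push r p p x = x"
  by (simp add: sphere_push_def sgn_div_norm)

text \<open>The bound on \<open>c - 1\<close> is the reverse triangle inequality for the norms of
  \<open>c *\<^sub>R y\<close> and \<open>x\<close>; the other follows by inserting
  \<open>c *\<^sub>R y\<close> between \<open>x\<close> and \<open>y\<close>.\<close>

lemma norm_diff_le_twice_norm_diff_scaleR:
  assumes "norm x = 1" "norm y = 1" "0 \<le> c"
  shows "norm (x - y) \<le> 2 * norm (x - c *\<^sub>R y)" "\<bar>c - 1\<bar> \<le> norm (x - c *\<^sub>R y)"
proof -
  show 1: "\<bar>c - 1\<bar> \<le> norm (x - c *\<^sub>R y)"
    using norm_triangle_ineq3[of "c *\<^sub>R y" x] assms by (simp add: norm_minus_commute)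
  have "norm (c *\<^sub>R y - y) = \<bar>c - 1\<bar>"
    using assms by (metis (no_types) mult.right_neutral norm_scaleR scaleR_left_diff_distrib scaleR_one)
  then show "norm (x - y) \<le> 2 * norm (x - c *\<^sub>R y)"
    using norm_triangle_ineq[of "x - c *\<^sub>R y" "c *\<^sub>R y - y"] 1 by simp
qed

lemma bump_lipschitz:
  fixes x y p :: "'a::euclidean_space"
  assumes "0 < r"
  shows "\<bar>max 0 (1 - dist x p / r) - max 0 (1 - dist y p / r)\<bar> \<le> dist x y / r"
proof -
  have "\<bar>dist x p / r - dist y p / r\<bar> \<le> dist x y / r"
    using assms abs_dist_diff_le[of x p y] by (simp add: diff_divide_distrib[symmetric] divide_right_mono dist_commute)
  then show ?thesis by (auto simp: max_def)
qed

lemma sphere_push_nonzero: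
  assumes "norm x = 1" "norm (q - p) < 1" "0 < r"
  shows "x + max 0 (1 - dist x p / r) *\<^sub>R (q - p) \<noteq> 0"
proof
  let ?b = "max 0 (1 - dist x p / r)"
  assume "x + ?b *\<^sub>R (q - p) = 0"
  then have "norm x = norm (?b *\<^sub>R (q - p))" by (metis add_eq_0_iff norm_minus_cancel)
  moreover have "?b \<le> 1" "0 \<le> ?b" using assms by auto
  then have "norm (?b *\<^sub>R (q - p)) \<le> norm (q - p)" by (simp add: mult_left_le_one_le)
  ultimately show False using assms by simp
qed

text \<open>If two points have the same image, the unprojected points satisfy
  \<open>u = c *\<^sub>R v\<close>. Then \<open>x - c *\<^sub>R y\<close> is a multiple of
  \<open>q - p\<close> whose norm \<open>?D\<close> is at most \<open>?D * (d + 2 * d / r)\<close>.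
  As \<open>d < r / 3\<close> and \<open>r \<le> 1\<close>, the factor is below
  \<open>1/3 + 2/3\<close>, so \<open>?D = 0\<close>.\<close>

lemma inj_on_sphere_push:
  fixes p q :: "'a::euclidean_space"
  assumes r: "0 < r" "r \<le> 1" and pq: "dist p q < r / 3"
  shows "inj_on (sphere_push r p q) (sphere 0 1)"
proof (rule inj_onI)
  fix x y :: 'a assume "x \<in> sphere 0 1" "y \<in> sphere 0 1" and eq: "sphere_push r p q x = sphere_push r p q y"
  then have n: "norm x = 1" "norm y = 1" by auto
  define d where "d = norm (q - p)"
  have d: "0 \<le> d" "d < r / 3" using pq by (auto simp: d_def dist_norm norm_minus_commute)
  define b where "b z = max 0 (1 - dist z p / r)" for z
  have b: "0 \<le> b z" "b z \<le> 1" for z using r by (auto simp: b_def)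
  define u v where "u = x + b x *\<^sub>R (q - p)" and "v = y + b y *\<^sub>R (q - p)"
  have nz: "u \<noteq> 0" "v \<noteq> 0"
    using sphere_push_nonzero[of x q p r] sphere_push_nonzero[of y q p r] n d r by (auto simp: u_def v_def b_def d_def)
  define c where "c = norm u / norm v"
  have "sgn u = sgn v" using eq by (simp add: sphere_push_def u_def v_def b_def)
  then have "norm u *\<^sub>R sgn u = (norm u / norm v) *\<^sub>R (norm v *\<^sub>R sgn v)" using nz by simp
  then have uv: "u = c *\<^sub>R v" using nz by (simp add: sgn_div_norm c_def)
  have c: "0 \<le> c" by (simp add: c_def)
  let ?D = "norm (x - c *\<^sub>R y)"
  \<comment> \<open>The first summand measures the change of scale, the second the variation of the
    bump; both are controlled by \<open>?D\<close>.\<close>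
  have "x - c *\<^sub>R y = ((c - 1) * b y) *\<^sub>R (q - p) + (b y - b x) *\<^sub>R (q - p)"
    using uv by (simp add: u_def v_def algebra_simps)
  then have "?D \<le> \<bar>c - 1\<bar> * b y * d + \<bar>b y - b x\<bar> * d"
    using norm_triangle_ineq[of "((c - 1) * b y) *\<^sub>R (q - p)" "(b y - b x) *\<^sub>R (q - p)"] b
    by (simp add: abs_mult d_def)
  also have "\<bar>c - 1\<bar> * b y * d \<le> ?D * 1 * d"
    using norm_diff_le_twice_norm_diff_scaleR(2)[OF n c] b d by (intro mult_mono) auto
  also have "\<bar>b y - b x\<bar> * d \<le> (2 * ?D / r) * d"
  proof (rule mult_right_mono)
    have "\<bar>b y - b x\<bar> \<le> dist y x / r" unfolding b_def by (rule bump_lipschitz[OF r(1)])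
    also have "\<dots> \<le> 2 * ?D / r"
      using norm_diff_le_twice_norm_diff_scaleR(1)[OF n c] r by (simp add: dist_norm norm_minus_commute divide_right_mono)
    finally show "\<bar>b y - b x\<bar> \<le> 2 * ?D / r" .
  qed (use d in simp)
  finally have "?D \<le> ?D * (d + 2 * d / r)" by (simp add: algebra_simps)
  moreover have "d + 2 * d / r < 1"
  proof -
    have "2 * d / r < 2 / 3" using d r by (simp add: field_simps)
    then show ?thesis using d r by simp
  qed
  ultimately have "?D * (1 - (d + 2 * d / r)) \<le> 0" "1 - (d + 2 * d / r) > 0" by (simp_all add: algebra_simps)
  then have "?D \<le> 0" by (simp add: mult_le_0_iff)
  then show "x = y" using norm_diff_le_twice_norm_diff_scaleR(1)[OF n c] by simp
qed

lemma sphere_isotopy_push: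
  fixes p :: "'a::euclidean_space"
  assumes "0 < r" "r \<le> 1" "\<And>t. dist p (q t) < r / 3" "continuous_on UNIV q"
  shows "sphere_isotopy (\<lambda>t. sphere_push r p (q t))"
  unfolding sphere_isotopy_def case_prod_unfold
proof (intro conjI allI)
  have small: "norm (q t - p) < 1" for t
    using assms(2) assms(3)[of t] by (simp add: dist_norm norm_minus_commute)
  note nz = sphere_push_nonzero[OF _ small assms(1)]
  show "inj_on (sphere_push r p (q t)) (sphere 0 1)" for t
    using assms by (intro inj_on_sphere_push) auto
  show "sphere_push r p (q t) \<in> sphere 0 1 \<rightarrow> sphere 0 1" for t
    using nz by (auto simp: sphere_push_def norm_sgn)
  show "continuous_on (UNIV \<times> sphere 0 1) (\<lambda>z. sphere_push r p (q (fst z)) (snd z))"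
    unfolding sphere_push_def sgn_div_norm
    by (intro continuous_intros continuous_on_compose2[OF assms(4)]) (use assms nz in auto)
qed

subsection \<open>Following finitely many moving points\<close>

locale moving_points =
  fixes J :: "'i set" and m :: "'i \<Rightarrow> real \<Rightarrow> 'a::euclidean_space"
  assumes finite: "finite J"
    and cont: "j \<in> J \<Longrightarrow> continuous_on UNIV (m j)"
    and unit: "j \<in> J \<Longrightarrow> norm (m j t) = 1"
    and distinct: "i \<in> J \<Longrightarrow> j \<in> J \<Longrightarrow> i \<noteq> j \<Longrightarrow> m i t \<noteq> m j t"
begin

text \<open>
  The points stop at time \<open>b\<close>, so that families for consecutive intervals can be
  composed for all times.
\<close>
definition follows :: "(real \<Rightarrow> 'a \<Rightarrow> 'a) \<Rightarrow> real \<Rightarrow> real \<Rightarrow> bool" where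
  "follows f a b \<longleftrightarrow> sphere_isotopy f \<and> (\<forall>t\<le>a. \<forall>x\<in>sphere 0 1. f t x = x) \<and>
     (\<forall>t\<ge>a. \<forall>j\<in>J. f t (m j a) = m j (min t b))"

text \<open>Up to time \<open>b\<close> the second family is the identity; afterwards the first has
  stopped at \<open>m j b\<close>, where the second starts.\<close>

lemma follows_trans:
  assumes f: "follows f a b" and g: "follows g b c" and "a \<le> b" "b \<le> c"
  shows "follows (\<lambda>t x. g t (f t x)) a c"
  unfolding follows_def
proof (intro conjI allI impI ballI)
  show "sphere_isotopy (\<lambda>t x. g t (f t x))"
    using f g sphere_isotopy_compose[of g f "\<lambda>t. t"] by (simp add: follows_def)
  show "g t (f t x) = x" if "t \<le> a" "x \<in> sphere 0 1" for t x
    using f g that assms(3) by (simp add: follows_def)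
  show "g t (f t (m j a)) = m j (min t c)" if "a \<le> t" "j \<in> J" for t j
    using f g that assms(3,4) by (cases "t \<le> b") (simp_all add: follows_def unit min_def)
qed

lemma separation:
  obtains e where "0 < e" "e \<le> 1" "\<And>i j. i \<in> J \<Longrightarrow> j \<in> J \<Longrightarrow> i \<noteq> j \<Longrightarrow> e \<le> dist (m i t) (m j t)"
proof -
  \<comment> \<open>The extra \<open>1\<close> keeps the set nonempty when there are no pairs and
    enforces \<open>e \<le> 1\<close>.\<close>
  let ?D = "insert 1 ((\<lambda>(i, j). dist (m i t) (m j t)) ` {(i, j) \<in> J \<times> J. i \<noteq> j})"
  have fin: "finite ?D" using finite by (auto intro: finite_subset[of _ "J \<times> J"])
  show thesis
  proof (rule that[of "Min ?D"])
    show "0 < Min ?D" using fin distinct by (subst Min_gr_iff) auto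
    show "Min ?D \<le> 1" using fin by (intro Min_le) auto
    show "Min ?D \<le> dist (m i t) (m j t)" if "i \<in> J" "j \<in> J" "i \<noteq> j" for i j
      using fin that by (intro Min_le) auto
  qed
qed

lemma common_modulus:
  assumes "0 < \<eta>"
  obtains d where "0 < d" "\<And>j t. j \<in> J \<Longrightarrow> \<bar>t - x\<bar> < d \<Longrightarrow> dist (m j t) (m j x) < \<eta>"
proof -
  have "\<forall>\<^sub>F t in nhds x. dist (m j t) (m j x) < \<eta>" if "j \<in> J" for j
    using cont[OF that] assms
    by (auto simp: continuous_on_eq_continuous_at isCont_def dest!: tendsto_at_iff_tendsto_nhds[THEN iffD1] elim: tendstoD)
  then have "\<forall>\<^sub>F t in nhds x. \<forall>j\<in>J. dist (m j t) (m j x) < \<eta>"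
    using finite by (simp add: eventually_ball_finite)
  then show thesis
    unfolding eventually_nhds_metric dist_real_def using that by blast
qed

text \<open>On a short interval the points stay so close to their starting positions that each can
  be moved by a push of radius \<open>e / 2\<close> whose support avoids all the others. The pushes
  are composed one point at a time.\<close>

lemma follows_short:
  assumes e: "0 < e" "e \<le> 1" "\<And>i j. i \<in> J \<Longrightarrow> j \<in> J \<Longrightarrow> i \<noteq> j \<Longrightarrow> e \<le> dist (m i x) (m j x)"
    and near: "\<And>j t. j \<in> J \<Longrightarrow> t \<in> {a..b} \<Longrightarrow> dist (m j t) (m j x) < e / 16" and "a \<le> b"
  shows "\<exists>f. follows f a b"
proof -
  \<comment> \<open>Clamping time to the interval makes every push the identity before
    \<open>a\<close> and stationary after \<open>b\<close>.\<close>
  define q where "q j t = m j (max a (min t b))" for j t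
  \<comment> \<open>Two hops of \<open>e / 16\<close> stay below \<open>e / 6\<close>, a third of
    the push radius, as \<open>sphere_isotopy_push\<close> requires.\<close>
  have q: "dist (m j a) (q j t) < e / 2 / 3" if "j \<in> J" for j t
    using near[of j a] near[of j "max a (min t b)"] \<open>a \<le> b\<close> that e(1) dist_triangle2[of "m j a" "q j t" "m j x"]
    by (simp add: q_def)
  have sep: "e / 2 \<le> dist (q i t) (m j a)" "e / 2 \<le> dist (m i a) (m j a)" if "i \<in> J" "j \<in> J" "i \<noteq> j" for i j t
  proof -
    have "e / 2 \<le> dist (m i s) (m j a)" if "s \<in> {a..b}" for s
      using near[of i s] near[of j a] e(3)[of i j] \<open>i \<in> J\<close> \<open>j \<in> J\<close> \<open>i \<noteq> j\<close> \<open>a \<le> b\<close> that e(1)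
        dist_triangle3[of "m i x" "m j x" "m i s"] dist_triangle[of "m i s" "m j x" "m j a"] by auto
    from this[of "max a (min t b)"] this[of a] \<open>a \<le> b\<close>
    show "e / 2 \<le> dist (q i t) (m j a)" "e / 2 \<le> dist (m i a) (m j a)" by (auto simp: q_def)
  qed
  \<comment> \<open>Induction on the set \<open>K\<close> of points already in motion. Both moved
    and resting points keep distance \<open>e / 2\<close> from \<open>m k a\<close>, so the next
    push fixes them.\<close>
  have "\<exists>f. sphere_isotopy f \<and> (\<forall>t\<le>a. \<forall>x\<in>sphere 0 1. f t x = x) \<and>
          (\<forall>t. \<forall>j\<in>J. f t (m j a) = (if j \<in> K then q j t else m j a))" if "K \<subseteq> J" for K
    using finite_subset[OF that finite] that
  proof (induction K)
    case empty
    show ?case using sphere_isotopy_id by (intro exI[of _ "\<lambda>t x. x"]) auto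
  next
    case (insert k K)
    then obtain f where f: "sphere_isotopy f" "\<And>t x. t \<le> a \<Longrightarrow> x \<in> sphere 0 1 \<Longrightarrow> f t x = x"
      "\<And>t j. j \<in> J \<Longrightarrow> f t (m j a) = (if j \<in> K then q j t else m j a)" by auto
    let ?p = "\<lambda>t. sphere_push (e / 2) (m k a) (q k t)"
    have k: "k \<in> J" using insert by simp
    have "continuous_on UNIV (q k)"
      unfolding q_def by (intro continuous_on_compose2[OF cont[OF k]] continuous_intros) auto
    then have "sphere_isotopy ?p"
      using e q[OF k] by (intro sphere_isotopy_push) auto
    then have "sphere_isotopy (\<lambda>t x. ?p t (f t x))"
      using f(1) sphere_isotopy_compose[of ?p f "\<lambda>t. t"] by simp
    moreover have "?p t (f t x) = x" if "t \<le> a" "x \<in> sphere 0 1" for t x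
      using f(2)[OF that] that \<open>a \<le> b\<close> by (simp add: q_def max_def sphere_push_same)
    moreover have "?p t (f t (m j a)) = (if j \<in> insert k K then q j t else m j a)" if "j \<in> J" for j t
    proof (cases "j = k")
      case True
      then show ?thesis using f(3)[OF k] \<open>k \<notin> K\<close> by (simp add: q_def sphere_push_center unit[OF k])
    next
      case False
      have "norm (q j t) = 1" using that by (simp add: q_def unit)
      then show ?thesis
        using False f(3)[OF that, of t] sep[OF that k False] e(1) unit[OF that]
        by (auto simp: sphere_push_far)
    qed
    ultimately show ?case by (intro exI[of _ "\<lambda>t x. ?p t (f t x)"]) blast
  qed
  from this[of J] obtain f where "sphere_isotopy f" "\<forall>t\<le>a. \<forall>x\<in>sphere 0 1. f t x = x"
     "\<forall>t. \<forall>j\<in>J. f t (m j a) = q j t" by auto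
  then show ?thesis unfolding follows_def q_def by (intro exI[of _ f]) (use \<open>a \<le> b\<close> in \<open>auto simp: max_def min_def\<close>)
qed

text \<open>Bisection: families on adjacent intervals concatenate, and near every time
  \<open>x\<close> all sufficiently short intervals are handled by
  \<open>follows_short\<close>.\<close>

lemma follows_exists:
  assumes "a \<le> b"
  shows "\<exists>f. follows f a b"
  using assms
proof (induction rule: Bolzano)
  case (trans a b c)
  then show ?case using follows_trans by blast
next
  case (local x)
  obtain e where e: "0 < e" "e \<le> 1" "\<And>i j. i \<in> J \<Longrightarrow> j \<in> J \<Longrightarrow> i \<noteq> j \<Longrightarrow> e \<le> dist (m i x) (m j x)"
    using separation[of x] by metis
  obtain d where d: "0 < d" "\<And>j t. j \<in> J \<Longrightarrow> \<bar>t - x\<bar> < d \<Longrightarrow> dist (m j t) (m j x) < e / 16"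
    using common_modulus[of "e / 16" x] e by auto
  have "\<exists>f. follows f a b" if "a \<le> x \<and> x \<le> b \<and> b - a < d" for a b
    using that by (intro follows_short[OF e] d(2)) auto
  with d(1) show ?case by blast
qed

text \<open>Families for consecutive unit intervals are composed infinitely often. This is harmless
  because at a given time all but finitely many factors are the identity.\<close>

lemma follows_infinite:
  "\<exists>f. sphere_isotopy f \<and> (\<forall>t\<le>0. \<forall>x\<in>sphere 0 1. f t x = x) \<and> (\<forall>t\<ge>0. \<forall>j\<in>J. f t (m j 0) = m j t)"
proof -
  have "\<forall>n::nat. \<exists>f. follows f n (n + 1)" using follows_exists by simp
  then obtain F where F: "follows (F n) (real n) (real n + 1)" for n by (metis of_nat_Suc add.commute)
  define P where "P = rec_nat (\<lambda>t x. x) (\<lambda>n p t x. F n t (p t x))"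
  have P_simps: "P 0 = (\<lambda>t x. x)" "P (Suc n) = (\<lambda>t x. F n t (P n t x))" for n
    by (simp_all add: P_def)
  have P: "follows (P n) 0 (real n)" for n
  proof (induction n)
    case 0
    show ?case using sphere_isotopy_id by (simp add: follows_def P_simps)
  next
    case (Suc n)
    then show ?case using follows_trans[OF Suc F] by (simp add: P_simps add.commute)
  qed
  have stable: "P k t x = P n t x" if "n \<le> k" "t \<le> real n" "x \<in> sphere 0 1" for n k t x
    using that(1)
  proof (induction k rule: dec_induct)
    case (step k)
    have "P k t x \<in> sphere 0 1" using P[of k] that(3) unfolding follows_def sphere_isotopy_def Pi_iff by blast
    moreover have "t \<le> real k" using that(2) step.hyps by linarith
    ultimately have "F k t (P k t x) = P k t x" using F[of k] by (auto simp: follows_def)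
    with step.IH show ?case by (simp add: P_simps)
  qed simp
  \<comment> \<open>For \<open>t \<le> 0\<close> the index is \<open>0\<close>, and
    \<open>P 0\<close> is the identity.\<close>
  define f where "f t x = P (nat \<lceil>t\<rceil>) t x" for t x
  have f: "f t x = P n t x" if "t \<le> real n" "x \<in> sphere 0 1" for t x n
    unfolding f_def by (rule stable[symmetric]) (use that in \<open>auto simp: nat_le_iff ceiling_le_iff real_nat_ceiling_ge\<close>)
  have "sphere_isotopy f"
    unfolding sphere_isotopy_def case_prod_unfold
  proof (intro conjI allI)
    fix t
    obtain n where n: "t \<le> real n" using real_arch_simple by blast
    show "inj_on (f t) (sphere 0 1)" "f t \<in> sphere 0 1 \<rightarrow> sphere 0 1"
      using P[of n] f[OF n] by (auto simp: follows_def sphere_isotopy_def inj_on_def Pi_iff)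
  next
    show "continuous_on (UNIV \<times> sphere 0 1) (\<lambda>z. f (fst z) (snd z))"
      unfolding continuous_on_eq_continuous_within
    proof
      fix z :: "real \<times> 'a" assume z: "z \<in> UNIV \<times> sphere 0 1"
      \<comment> \<open>The strict inequality makes the same \<open>n\<close> work for all nearby
        times, so \<open>f\<close> agrees locally with the continuous \<open>P n\<close>.\<close>
      obtain n where n: "fst z < real n" using reals_Archimedean2 by blast
      have "continuous_on (UNIV \<times> sphere 0 1) (\<lambda>z. P n (fst z) (snd z))"
        using P[of n] by (simp add: follows_def sphere_isotopy_def case_prod_unfold)
      then have "continuous (at z within UNIV \<times> sphere 0 1) (\<lambda>z. P n (fst z) (snd z))"
        using z unfolding continuous_on_eq_continuous_within by blast
      then show "continuous (at z within UNIV \<times> sphere 0 1) (\<lambda>z. f (fst z) (snd z))"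
      proof (rule continuous_transform_within_openin)
        show "openin (top_of_set (UNIV \<times> sphere 0 1)) ((UNIV \<times> sphere 0 1) \<inter> ({..<real n} \<times> UNIV))"
          by (intro openin_open_Int open_Times) auto
        show "z \<in> (UNIV \<times> sphere 0 1) \<inter> ({..<real n} \<times> UNIV)" using z n by (cases z) auto
        show "P n (fst y) (snd y) = f (fst y) (snd y)" if "y \<in> (UNIV \<times> sphere 0 1) \<inter> ({..<real n} \<times> UNIV)" for y
          using that f[of "fst y" n "snd y"] by (cases y) auto
      qed
    qed
  qed
  moreover have "f t x = x" if "t \<le> 0" "x \<in> sphere 0 1" for t x
    using f[of t 0 x] that by (simp add: P_simps)
  moreover have "f t (m j 0) = m j t" if "0 \<le> t" "j \<in> J" for t j
  proof -
    obtain n where n: "t \<le> real n" using real_arch_simple by blast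
    show ?thesis using f[OF n, of "m j 0"] P[of n] that n by (simp add: unit follows_def)
  qed
  ultimately show ?thesis by blast
qed

end

text \<open>One family follows the points forwards, another follows the time-reversed points. Each
  is the identity on the half-line of times belonging to the other, so their composite serves all
  times.\<close>

lemma moving_points_isotopy:
  assumes "moving_points J m"
  shows "\<exists>f. sphere_isotopy f \<and> (\<forall>t. \<forall>j\<in>J. f t (m j 0) = m j t)"
proof -
  interpret moving_points J m by (rule assms)
  interpret rev: moving_points J "\<lambda>j t. m j (- t)"
    using finite unit distinct
    by unfold_locales (auto intro!: continuous_on_compose2[OF cont] continuous_intros)
  obtain f where f: "sphere_isotopy f" "\<forall>t\<le>0. \<forall>x\<in>sphere 0 1. f t x = x"
    "\<forall>t\<ge>0. \<forall>j\<in>J. f t (m j 0) = m j t"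
    using follows_infinite by blast
  obtain g where g: "sphere_isotopy g" "\<forall>t\<le>0. \<forall>x\<in>sphere 0 1. g t x = x"
    "\<forall>t\<ge>0. \<forall>j\<in>J. g t (m j 0) = m j (- t)"
    using rev.follows_infinite by auto
  have "sphere_isotopy (\<lambda>t x. f t (g (- t) x))"
    by (rule sphere_isotopy_compose[OF f(1) g(1)]) (intro continuous_intros)
  moreover have "f t (g (- t) (m j 0)) = m j t" if "j \<in> J" for t j
    using f g that unit[OF that] by (cases "0 \<le> t") auto
  ultimately show ?thesis by blast
qed

subsection \<open>One-dimensional submanifolds\<close>

text \<open>A slice chart parametrises \<open>L\<close> near each point by an open set of reals;
  composing with \<open>f\<close> reduces the claim to invariance of domain on the real
  line.\<close>

lemma open_image_one_dim_submanifold: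
  fixes f :: "real^3 \<Rightarrow> real"
  assumes L: "one_dim_submanifold M L" and W: "openin (top_of_set L) W"
    and f: "continuous_on W f" "inj_on f W"
  shows "open (f ` W)"
proof (subst open_subopen, clarify)
  fix x assume "x \<in> W"
  then have "x \<in> L" using W openin_imp_subset by blast
  obtain U and V :: "(real^3) set" and \<phi> \<psi> where U: "openin (top_of_set M) U" "x \<in> U" and V: "open V" and h: "homeomorphism U V \<phi> \<psi>"
    and sl: "\<phi> ` (U \<inter> L) = V \<inter> {y. y $ 2 = 0 \<and> y $ 3 = 0}"
    using L \<open>x \<in> L\<close> unfolding one_dim_submanifold_def by meson
  obtain B where B: "open B" "W = L \<inter> B" using W by (auto simp: openin_open)
  note \<psi> = homeomorphism_cont2[OF h]
  have "open (V \<inter> \<psi> -` B)"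
    using continuous_open_preimage[OF \<psi> V B(1)] .
  \<comment> \<open>The first coordinate axis, shifted so that parameter \<open>0\<close> gives the
    chart image of \<open>x\<close>.\<close>
  define \<gamma> where "\<gamma> s = \<phi> x + s *\<^sub>R (axis 1 1 :: real^3)" for s
  have \<gamma>: "continuous_on UNIV \<gamma>" "inj \<gamma>"
    unfolding \<gamma>_def by (auto intro!: continuous_intros simp: inj_def axis_eq_0_iff)
  define I where "I = \<gamma> -` (V \<inter> \<psi> -` B)"
  have "open I" unfolding I_def
    using \<open>open (V \<inter> \<psi> -` B)\<close> \<gamma>(1) by (intro continuous_open_vimage) (auto simp: continuous_on_eq_continuous_at)
  have "\<phi> x \<in> V \<inter> {y. y $ 2 = 0 \<and> y $ 3 = 0}" using sl U(2) \<open>x \<in> L\<close> by blast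
  then have "0 \<in> I"
    using homeomorphism_apply1[OF h U(2)] \<open>x \<in> W\<close> B by (auto simp: I_def \<gamma>_def)
  have sub: "\<psi> (\<gamma> s) \<in> W" if "s \<in> I" for s
  proof -
    have "\<gamma> s \<in> V \<inter> {y. y $ 2 = 0 \<and> y $ 3 = 0}"
      using that \<open>\<phi> x \<in> V \<inter> {y. y $ 2 = 0 \<and> y $ 3 = 0}\<close> by (auto simp: I_def \<gamma>_def axis_def)
    then have "\<psi> (\<gamma> s) \<in> L" unfolding sl[symmetric] using homeomorphism_apply1[OF h] by auto
    then show ?thesis using that B by (auto simp: I_def)
  qed
  have "\<gamma> ` I \<subseteq> V" by (auto simp: I_def)
  then have "continuous_on I (\<lambda>s. f (\<psi> (\<gamma> s)))"
    using sub by (intro continuous_on_compose2[OF f(1)] continuous_on_compose2[OF \<psi>]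
        continuous_on_subset[OF \<gamma>(1)]) auto
  moreover have "inj_on (\<lambda>s. f (\<psi> (\<gamma> s))) I"
    using f(2) sub \<gamma>(2) homeomorphism_apply2[OF h] \<open>\<gamma> ` I \<subseteq> V\<close>
    unfolding inj_on_def by (metis UNIV_I image_subset_iff)
  ultimately have "open ((\<lambda>s. f (\<psi> (\<gamma> s))) ` I)"
    using \<open>open I\<close> by (intro invariance_of_domain)
  moreover have "f x \<in> (\<lambda>s. f (\<psi> (\<gamma> s))) ` I"
    using \<open>0 \<in> I\<close> homeomorphism_apply1[OF h U(2)] by (force simp: \<gamma>_def)
  ultimately show "\<exists>T. open T \<and> f x \<in> T \<and> T \<subseteq> f ` W" using sub by blast
qed

text \<open>By the preceding lemma \<open>f\<close> is an open map on \<open>L\<close>, and the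
  preimage of \<open>B\<close> under the inverse is the image of
  \<open>L \<inter> B\<close>.\<close>

lemma continuous_inverse_one_dim_submanifold:
  fixes f :: "real^3 \<Rightarrow> real"
  assumes "one_dim_submanifold M L" "continuous_on L f" "inj_on f L" "f ` L = UNIV"
  shows "continuous_on UNIV (inv_into L f)"
proof (subst continuous_on_open_vimage[OF open_UNIV], intro allI impI)
  fix B :: "(real^3) set" assume "open B"
  have "inv_into L f -` B \<inter> UNIV = f ` (L \<inter> B)"
  proof (intro set_eqI iffI)
    fix t assume "t \<in> inv_into L f -` B \<inter> UNIV"
    then show "t \<in> f ` (L \<inter> B)" using assms(4)
      by (intro image_eqI[of _ _ "inv_into L f t"]) (auto simp: f_inv_into_f inv_into_into)
  qed (use assms(3) in auto)
  moreover have "open (f ` (L \<inter> B))"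
    using assms \<open>open B\<close>
    by (intro open_image_one_dim_submanifold[OF assms(1)] openin_open_Int)
      (auto intro: continuous_on_subset inj_on_subset)
  ultimately show "open (inv_into L f -` B \<inter> UNIV)" by simp
qed

subsection \<open>Radial extension of isotopies\<close>

text \<open>The range is open by invariance of domain. It is closed because points of the range near
  \<open>y\<close> come from a fixed ball, whose image is compact. By connectedness it is
  everything.\<close>

lemma homeomorphism_norm_preserving:
  fixes g :: "'a::euclidean_space \<Rightarrow> 'a"
  assumes "continuous_on UNIV g" "inj g" and norm: "\<And>x. norm (g x) = norm x"
  shows "\<exists>g'. homeomorphism UNIV UNIV g g'"
proof -
  have "open (range g)" using assms by (intro invariance_of_domain) auto
  moreover have "closed (range g)"
  proof (rule closure_subset_eq[THEN iffD1], rule subsetI)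
    fix y assume "y \<in> closure (range g)"
    then have "y \<in> closure (ball y 1 \<inter> range g)"
      using open_Int_closure_subset[of "ball y 1" "range g"] by auto
    moreover have "ball y 1 \<inter> range g \<subseteq> g ` cball 0 (norm y + 1)"
    proof clarify
      fix x assume "g x \<in> ball y 1"
      then have "norm (g x) \<le> norm y + 1"
        using norm_triangle_ineq2[of "g x" y] by (simp add: dist_norm norm_minus_commute)
      then show "g x \<in> g ` cball 0 (norm y + 1)" by (simp add: norm)
    qed
    moreover have "closed (g ` cball 0 (norm y + 1))"
      by (intro compact_imp_closed compact_continuous_image continuous_on_subset[OF assms(1)]) auto
    ultimately show "y \<in> range g" by (meson closure_minimal image_mono subset_UNIV subsetD)
  qed
  ultimately have "range g = UNIV" using clopen[of "range g"] by auto
  then show ?thesis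
    using invariance_of_domain_homeomorphism[of UNIV g] assms by (metis open_UNIV order_refl)
qed

lemma radial_homeomorphism:
  fixes f :: "real \<Rightarrow> 'a::euclidean_space \<Rightarrow> 'a"
  assumes f: "sphere_isotopy f"
  defines "g \<equiv> \<lambda>x. norm x *\<^sub>R f (ln (norm x)) (sgn x)"
  shows "\<exists>g'. homeomorphism UNIV UNIV g g'"
proof (rule homeomorphism_norm_preserving)
  have f1: "norm (f t x) = 1" if "norm x = 1" for t x
    using f that unfolding sphere_isotopy_def by (auto simp: Pi_iff)
  show norm: "norm (g x) = norm x" for x
    by (cases "x = 0") (simp_all add: g_def f1 norm_sgn)
  show "inj g"
  proof (rule injI)
    fix x y assume eq: "g x = g y"
    then have n: "norm x = norm y" by (metis norm)
    show "x = y"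
    proof (cases "x = 0")
      case False
      then have "y \<noteq> 0" using n by auto
      then have "f (ln (norm x)) (sgn x) = f (ln (norm x)) (sgn y)" using eq n by (simp add: g_def)
      then have "sgn x = sgn y" using f False \<open>y \<noteq> 0\<close> unfolding sphere_isotopy_def inj_on_def by (simp add: norm_sgn)
      then show ?thesis using n False \<open>y \<noteq> 0\<close> by (simp add: sgn_div_norm)
    qed (use n in simp)
  qed
  have "continuous_on (- {0}) g"
    unfolding g_def
  proof (intro continuous_intros)
    show "continuous_on (- {0}) (\<lambda>x. f (ln (norm x)) (sgn x))"
      using f unfolding sphere_isotopy_def case_prod_unfold sgn_div_norm
      by (intro continuous_on_compose2[of "UNIV \<times> sphere 0 1" "\<lambda>z. f (fst z) (snd z)" _ "\<lambda>x. (ln (norm x), x /\<^sub>R norm x)", simplified]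
          continuous_intros) auto
  qed
  then have "isCont g x" if "x \<noteq> 0" for x
    using that by (simp add: continuous_on_eq_continuous_at open_Compl)
  \<comment> \<open>At the origin \<open>ln (norm x)\<close> tends to minus infinity, where
    \<open>f\<close> need not converge; preservation of the norm alone gives continuity.\<close>
  moreover have "(g \<longlongrightarrow> 0) (at 0)"
    by (rule Lim_null_comparison[of _ norm]) (auto simp: norm tendsto_norm_zero)
  then have "isCont g 0" by (simp add: isCont_def g_def)
  ultimately show "continuous_on UNIV g"
    by (metis continuous_at_imp_continuous_on)
qed

subsection \<open>The ends of punctured space\<close>

lemma connected_punctured_ball:
  "connected (ball (0::real^3) e - {0})"
  by (intro connected_open_delete) (auto simp: DIM_cart)

text \<open>The preimage of a compact shell misses a small punctured ball about the origin. The
  connected image of that ball lies entirely inside or entirely outside the shell, and outside is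
  impossible when \<open>G\<close> does not tend to infinity.\<close>

lemma punctured_ends:
  fixes G :: "real^3 \<Rightarrow> real^3"
  assumes G: "homeomorphism (UNIV - {0}) (UNIV - {0}) G G'"
  shows "(G \<longlongrightarrow> 0) (at 0) \<or> filterlim G at_infinity (at 0)"
proof (rule disjCI)
  assume "\<not> filterlim G at_infinity (at 0)"
  then obtain r where r: "0 < r" "\<not> (\<forall>\<^sub>F x in at 0. r \<le> norm (G x))"
    using filterlim_at_infinity[of 0 G "at 0"] by auto
  show "(G \<longlongrightarrow> 0) (at 0)"
  proof (rule tendstoI)
    fix e :: real assume "0 < e"
    \<comment> \<open>\<open>R \<ge> r\<close> excludes the outer side, \<open>1 / R \<le> e\<close>
      makes the inner side small enough, and \<open>R \<ge> 1\<close> keeps the two sides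
      disjoint.\<close>
    define R where "R = max r (max 1 (1 / e))"
    have R: "1 \<le> R" "0 < R" "r \<le> R" "1 / R \<le> e" 
    proof -
      have "1 / e \<le> R" by (simp add: R_def)
      then show "1 \<le> R" "0 < R" "r \<le> R" "1 / R \<le> e"
        using \<open>0 < e\<close> by (auto simp: R_def field_simps)
    qed
    define K where "K = cball 0 R - ball (0::real^3) (1 / R)"
    have "compact K" unfolding K_def by (intro compact_diff) auto
    have K0: "K \<subseteq> UNIV - {0}" using R by (auto simp: K_def)
    have "compact (G' ` K)"
      using homeomorphism_cont2[OF G] \<open>compact K\<close> K0 by (metis compact_continuous_image continuous_on_subset)
    moreover have "0 \<in> - G' ` K" using homeomorphism_image2[OF G] K0 by blast
    ultimately obtain d where d: "0 < d" "ball 0 d \<subseteq> - G' ` K"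
      by (meson compact_imp_closed open_Compl open_contains_ball)
    define C where "C = G ` (ball 0 d - {0})"
    have "connected C" unfolding C_def
      by (intro connected_continuous_image connected_punctured_ball continuous_on_subset[OF homeomorphism_cont1[OF G]]) auto
    moreover have "C \<inter> K = {}"
    proof -
      have "G x \<notin> K" if "x \<in> ball 0 d - {0}" for x
        using d(2) that homeomorphism_apply1[OF G, of x] by force
      then show ?thesis unfolding C_def by blast
    qed
    then have "C \<subseteq> ball 0 (1 / R) \<union> - cball 0 R" by (auto simp: K_def)
    moreover have "ball 0 (1 / R) \<inter> - cball 0 R \<inter> C = {}"
    proof -
      have "1 / R \<le> R" using R by (simp add: divide_le_eq mult_ge1_I)
      then show ?thesis by auto
    qed
    ultimately have "ball 0 (1 / R) \<inter> C = {} \<or> - cball 0 R \<inter> C = {}"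
      using connectedD[of C "ball 0 (1 / R)" "- cball 0 R"] by (simp add: open_Compl)
    with \<open>C \<subseteq> ball 0 (1 / R) \<union> - cball 0 R\<close>
    have "C \<subseteq> ball 0 (1 / R) \<or> C \<subseteq> - cball 0 R" by blast
    moreover have "\<not> C \<subseteq> - cball 0 R"
    proof
      assume "C \<subseteq> - cball 0 R"
      then have "\<forall>\<^sub>F x in at 0. r \<le> norm (G x)"
        unfolding eventually_at using d(1) R(3) by (intro exI[of _ d]) (force simp: C_def dist_norm)
      with r show False by simp
    qed
    ultimately have "C \<subseteq> ball 0 (1 / R)" by blast
    then show "\<forall>\<^sub>F x in at 0. dist (G x) 0 < e"
      unfolding eventually_at using d(1) R(4) by (intro exI[of _ d]) (force simp: C_def)
  qed
qed

section \<open>Inversion and the exchange of the two ends\<close>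

definition inversion :: "'a::real_normed_vector \<Rightarrow> 'a" where
  "inversion x = x /\<^sub>R (norm x)\<^sup>2"

lemma norm_inversion: "norm (inversion x) = 1 / norm x"
  by (cases "x = 0") (simp_all add: inversion_def power2_eq_square field_simps)

lemma inversion_inversion: "inversion (inversion x) = x"
  by (cases "x = 0") (simp_all add: inversion_def power2_eq_square field_simps)

lemma homeomorphism_inversion: "homeomorphism (UNIV - {0}) (UNIV - {0}) inversion inversion"
proof (rule homeomorphismI)
  show "continuous_on (UNIV - {0}) inversion"
    unfolding inversion_def by (intro continuous_intros) auto
  then show "continuous_on (UNIV - {0}) inversion" .
qed (auto simp: inversion_inversion, auto simp: inversion_def)

lemma inversion_sphere:
  "0 < t \<Longrightarrow> inversion ` sphere 0 t = sphere (0::'a::real_normed_vector) (1 / t)"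
proof (intro equalityI subsetI)
  fix x :: 'a assume "0 < t" "x \<in> sphere 0 (1 / t)"
  then show "x \<in> inversion ` sphere 0 t"
    by (intro image_eqI[of _ _ "inversion x"]) (simp_all add: norm_inversion inversion_inversion)
qed (auto simp: norm_inversion)

text \<open>If \<open>G\<close> swaps the ends, precomposing with the inversion repairs this. The
  inversion permutes the round spheres about the origin, so the leaves remain the same sets.\<close>

lemma punctured_end_fixing:
  fixes G :: "real^3 \<Rightarrow> real^3"
  assumes G: "homeomorphism (UNIV - {0}) (UNIV - {0}) G G'"
  shows "\<exists>(K :: real^3 \<Rightarrow> real^3) K'. homeomorphism (UNIV - {0}) (UNIV - {0}) K K' \<and> (K \<longlongrightarrow> 0) (at 0) \<and>
     (\<forall>t>0. \<exists>s>0. K ` sphere 0 t = G ` sphere 0 s)"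
proof (cases "(G \<longlongrightarrow> 0) (at 0)")
  case True
  then show ?thesis using G by (intro exI[of _ G] exI[of _ G']) auto
next
  case False
  then have "filterlim G at_infinity (at 0)" using punctured_ends[OF G] by blast
  then have "\<forall>\<^sub>F x in at 0. 1 \<le> norm (G x)"
    using filterlim_at_infinity[of 0 G "at 0"] by auto
  then obtain d where d: "0 < d" "\<And>x. x \<noteq> 0 \<Longrightarrow> norm x < d \<Longrightarrow> 1 \<le> norm (G x)"
    unfolding eventually_at by auto
  have I: "homeomorphism (UNIV - {0}) (UNIV - {0}) (G \<circ> inversion) (inversion \<circ> G')"
    by (rule homeomorphism_compose[OF homeomorphism_inversion G])
  \<comment> \<open>Otherwise \<open>G\<close> would be bounded away from zero near both ends, and
    on the compact shell in between as well, contradicting surjectivity.\<close>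
  have "\<not> filterlim (G \<circ> inversion) at_infinity (at 0)"
  proof
    assume "filterlim (G \<circ> inversion) at_infinity (at 0)"
    then have "\<forall>\<^sub>F x in at 0. 1 \<le> norm ((G \<circ> inversion) x)"
      using filterlim_at_infinity[of 0 "G \<circ> inversion" "at 0"] by auto
    then obtain e where e: "0 < e" "\<And>x. x \<noteq> 0 \<Longrightarrow> norm x < e \<Longrightarrow> 1 \<le> norm (G (inversion x))"
      unfolding eventually_at by auto
    define K where "K = cball 0 (1 / e) - ball (0::real^3) d"
    have "compact K" unfolding K_def by (intro compact_diff) auto
    moreover have K0: "K \<subseteq> UNIV - {0}" using d by (auto simp: K_def)
    ultimately have "compact (G ` K)"
      using homeomorphism_cont1[OF G] by (metis compact_continuous_image continuous_on_subset)
    moreover have "0 \<in> - G ` K" using homeomorphism_image1[OF G] K0 by blast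
    ultimately obtain c where c: "0 < c" "ball 0 c \<subseteq> - G ` K"
      by (meson compact_imp_closed open_Compl open_contains_ball)
    \<comment> \<open>A nonzero point too short to be a value of \<open>G\<close> on
      \<open>K\<close> (norm below \<open>c\<close>) or outside \<open>K\<close> (norm below
      \<open>1\<close>).\<close>
    define y :: "real^3" where "y = (min c 1 / 2) *\<^sub>R axis 1 1"
    have y: "y \<noteq> 0" "norm y < c" "norm y < 1" using c by (auto simp: y_def axis_eq_0_iff)
    define x where "x = G' y"
    have x: "x \<noteq> 0" "G x = y" using homeomorphism_image2[OF G] homeomorphism_apply2[OF G] y(1) by (auto simp: x_def)
    have "d \<le> norm x" using d(2)[OF x(1)] x(2) y(3) by force
    moreover have "norm x \<le> 1 / e"
    proof (rule ccontr)
      assume "\<not> norm x \<le> 1 / e"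
      then have "norm (inversion x) < e" using e(1) x(1) by (simp add: norm_inversion field_simps)
      moreover have "inversion x \<noteq> 0" using x(1) by (simp add: inversion_def)
      ultimately show False using e(2)[of "inversion x"] x(2) y(3) by (simp add: inversion_inversion)
    qed
    ultimately have "x \<in> K" by (simp add: K_def)
    then show False using c(2) x(2) y(2) by auto
  qed
  then have "((G \<circ> inversion) \<longlongrightarrow> 0) (at 0)" using punctured_ends[OF I] by blast
  moreover have "\<exists>s>0. (G \<circ> inversion) ` sphere 0 t = G ` sphere 0 s" if "0 < t" for t
  proof (intro exI[of _ "1 / t"] conjI)
    show "(G \<circ> inversion) ` sphere 0 t = G ` sphere 0 (1 / t)"
      unfolding image_comp[symmetric] inversion_sphere[OF that] ..
  qed (use that in simp)
  ultimately show ?thesis using I by blast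
qed

lemma homeomorphism_extend_zero:
  fixes G :: "real^3 \<Rightarrow> real^3"
  assumes G: "homeomorphism (UNIV - {0}) (UNIV - {0}) G G'" and lim: "(G \<longlongrightarrow> 0) (at 0)"
  shows "\<exists>h h'. homeomorphism UNIV UNIV h h' \<and> h 0 = 0 \<and> (\<forall>x. x \<noteq> 0 \<longrightarrow> h x = G x)"
proof -
  define h where "h = G(0 := 0)"
  have "isCont h x" for x
  proof (cases "x = 0")
    case True
    then show ?thesis using lim by (simp add: isCont_def h_def cong: Lim_cong_within)
  next
    case False
    then have "isCont G x"
      using homeomorphism_cont1[OF G] by (simp add: continuous_on_eq_continuous_at open_delete)
    moreover have "\<forall>\<^sub>F y in nhds x. h y = G y"
      by (rule eventually_mono[OF eventually_nhds_in_open[of "- {0}" x]]) (use False in \<open>auto simp: h_def open_Compl\<close>)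
    ultimately show ?thesis using isCont_cong by blast
  qed
  then have "continuous_on UNIV h" by (simp add: continuous_at_imp_continuous_on)
  moreover have "inj h"
  proof (rule injI)
    fix x y assume "h x = h y"
    moreover have "G z \<noteq> 0" "G' (G z) = z" if "z \<noteq> 0" for z
      using that homeomorphism_apply1[OF G, of z] homeomorphism_image1[OF G] by auto
    ultimately show "x = y" by (metis fun_upd_apply h_def)
  qed
  moreover have "range h = UNIV"
  proof -
    have "y \<in> range h" for y
    proof (cases "y = 0")
      case False
      then have "G' y \<noteq> 0" "G (G' y) = y"
        using homeomorphism_apply2[OF G, of y] homeomorphism_image2[OF G] by auto
      then have "y = h (G' y)" by (simp add: h_def)
      then show ?thesis by (rule range_eqI)
    qed (auto simp: h_def intro: range_eqI[of _ _ 0])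
    then show ?thesis by (intro equalityI subsetI) auto
  qed
  ultimately obtain h' where "homeomorphism UNIV UNIV h h'"
    using invariance_of_domain_homeomorphism[of UNIV h] by (metis open_UNIV order_refl)
  then show ?thesis by (intro exI[of _ h] exI[of _ h']) (simp add: h_def)
qed

subsection \<open>From a transverse foliation to tameness\<close>

lemma tame_frame_if_transverse_foliation:
  fixes G G' :: "real^3 \<Rightarrow> real^3"
  assumes L: "arcs_of_frame \<nu> L" and G: "homeomorphism (UNIV - {0}) (UNIV - {0}) G G'"
    and single: "\<And>t j. 0 < t \<Longrightarrow> j \<in> {1..\<nu>} \<Longrightarrow> \<exists>p. G ` sphere 0 t \<inter> L j = {p}"
  shows "tame_frame \<nu> (frame \<nu> L)"
proof -
  obtain K K' :: "real^3 \<Rightarrow> real^3" where K: "homeomorphism (UNIV - {0}) (UNIV - {0}) K K'" "(K \<longlongrightarrow> 0) (at 0)"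
    and sph: "\<And>t. 0 < t \<Longrightarrow> \<exists>s>0. K ` sphere 0 t = G ` sphere 0 s"
    using punctured_end_fixing[OF G] by metis
  have singleK: "\<exists>p. K ` sphere 0 t \<inter> L j = {p}" if "0 < t" "j \<in> {1..\<nu>}" for t j
    using single[OF _ that(2)] sph[OF that(1)] by metis
  obtain h h' where h: "homeomorphism UNIV UNIV h h'" "h 0 = 0" "\<And>x. x \<noteq> 0 \<Longrightarrow> h x = K x"
    using homeomorphism_extend_zero[OF K] by metis
  have sub: "one_dim_submanifold (UNIV - {0}) (L j)" "L j \<subseteq> UNIV - {0}" if "j \<in> {1..\<nu>}" for j
    using L that by (auto simp: arcs_of_frame_def infinite_arc_def one_dim_submanifold_def)
  have K'0: "K' y \<noteq> 0" "K (K' y) = y" if "y \<noteq> 0" for y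
    using homeomorphism_image2[OF K(1)] homeomorphism_apply2[OF K(1)] that by auto
  \<comment> \<open>\<open>N\<close> labels the leaf through \<open>y\<close> by the logarithm of
    its radius. Single intersections make it a bijection from each arc to the reals, and
    \<open>c j\<close> parametrises the arc by this label.\<close>
  define N where "N y = ln (norm (K' y))" for y
  define c where "c j = inv_into (L j) N" for j
  have N: "continuous_on (L j) N" "inj_on N (L j)" "N ` L j = UNIV" if j: "j \<in> {1..\<nu>}" for j
  proof -
    show "continuous_on (L j) N"
      unfolding N_def using sub(2)[OF j] K'0
      by (intro continuous_intros continuous_on_subset[OF homeomorphism_cont2[OF K(1)]]) auto
    show "inj_on N (L j)"
    proof (rule inj_onI)
      fix x y assume xy: "x \<in> L j" "y \<in> L j" "N x = N y"
      then have nz: "x \<noteq> 0" "y \<noteq> 0" using sub(2)[OF j] by auto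
      then have "norm (K' x) = norm (K' y)" using xy(3) K'0 by (simp add: N_def)
      then have "x \<in> K ` sphere 0 (norm (K' x)) \<inter> L j" "y \<in> K ` sphere 0 (norm (K' x)) \<inter> L j"
        using K'0(2)[OF nz(1)] K'0(2)[OF nz(2)] xy by (auto intro!: image_eqI[of _ K, OF sym])
      then show "x = y" using singleK[of "norm (K' x)" j] K'0(1)[OF nz(1)] j
        by (metis singletonD zero_less_norm_iff)
    qed
    have "t \<in> N ` L j" for t
    proof -
      obtain p where "K ` sphere 0 (exp t) \<inter> L j = {p}" using singleK[OF exp_gt_zero j] by blast
      then have "p \<in> K ` sphere 0 (exp t)" "p \<in> L j" by blast+
      then obtain x where x: "norm x = exp t" "K x \<in> L j" by auto
      then have "x \<noteq> 0" by auto
      then have "N (K x) = t" using homeomorphism_apply1[OF K(1), of x] x by (simp add: N_def)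
      then show ?thesis using x by force
    qed
    then show "N ` L j = UNIV" by blast
  qed
  have c: "c j t \<in> L j" "N (c j t) = t" "norm (K' (c j t)) = exp t" "continuous_on UNIV (c j)" if "j \<in> {1..\<nu>}" for j t
  proof -
    show 1: "c j t \<in> L j" and 2: "N (c j t) = t"
      using N(3)[OF that] by (auto simp: c_def inv_into_into f_inv_into_f)
    show "norm (K' (c j t)) = exp t"
    proof -
      have "K' (c j t) \<noteq> 0" using 1 sub(2)[OF that] by (intro K'0(1)) auto
      then have "exp (N (c j t)) = norm (K' (c j t))" by (simp add: N_def)
      then show ?thesis by (simp add: 2)
    qed
    show "continuous_on UNIV (c j)"
      unfolding c_def using sub(1)[OF that] N[OF that] by (rule continuous_inverse_one_dim_submanifold)
  qed
  define m where "m j t = sgn (K' (c j t))" for j t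
  have m: "K' (c j t) = exp t *\<^sub>R m j t" "norm (m j t) = 1" if "j \<in> {1..\<nu>}" for j t
  proof -
    have "K' (c j t) \<noteq> 0" using c(3)[OF that, of t] by auto
    then show "K' (c j t) = exp t *\<^sub>R m j t" "norm (m j t) = 1"
      by (simp_all add: m_def sgn_div_norm c(3)[OF that])
  qed
  have "moving_points {1..\<nu>} m"
  proof
    show "continuous_on UNIV (m j)" if j: "j \<in> {1..\<nu>}" for j
      unfolding m_def sgn_div_norm using c[OF j] sub(2)[OF j]
      by (intro continuous_intros continuous_on_compose2[OF homeomorphism_cont2[OF K(1)]]) auto
    \<comment> \<open>The points \<open>K' (c i t)\<close> and \<open>K' (c j t)\<close> have the
      same norm \<open>exp t\<close>; equal directions would give disjoint arcs a common
      point.\<close>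
    show "m i t \<noteq> m j t" if ij: "i \<in> {1..\<nu>}" "j \<in> {1..\<nu>}" "i \<noteq> j" for i j t
    proof
      assume "m i t = m j t"
      then have "K' (c i t) = K' (c j t)" using m(1) ij by metis
      then have "c i t = c j t"
        using K'0(2) c(1)[OF ij(1), of t] c(1)[OF ij(2), of t] sub(2) ij by (metis Diff_iff singletonI subsetD)
      then show False
        using L ij c(1)[OF ij(1), of t] c(1)[OF ij(2), of t] unfolding arcs_of_frame_def disjoint_family_on_def by (metis IntI empty_iff)
    qed
  qed (use m in auto)
  then obtain f where f: "sphere_isotopy f" "\<And>t j. j \<in> {1..\<nu>} \<Longrightarrow> f t (m j 0) = m j t"
    using moving_points_isotopy by metis
  \<comment> \<open>\<open>g\<close> bends the ray through \<open>m j 0\<close> into the preimage of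
    \<open>L j\<close> under \<open>K\<close>; \<open>h\<close>, the extension of \<open>K\<close>
    over the origin, then carries it onto \<open>L j\<close>.\<close>
  define g where "g x = norm x *\<^sub>R f (ln (norm x)) (sgn x)" for x
  obtain g' where g: "homeomorphism UNIV UNIV g g'"
    using radial_homeomorphism[OF f(1)] unfolding g_def by blast
  have H: "homeomorphism UNIV UNIV (h \<circ> g) (g' \<circ> h')" by (rule homeomorphism_compose[OF g h(1)])
  define R where "R j = {t *\<^sub>R m j 0 |t. 0 < t}" for j
  have hg: "(h \<circ> g) (exp t *\<^sub>R m j 0) = c j t" if "j \<in> {1..\<nu>}" for j t
  proof -
    have nz: "c j t \<noteq> 0" using c(1)[OF that, of t] sub(2)[OF that] by auto
    have "sgn (m j 0) = m j 0" by (simp add: sgn_div_norm m(2)[OF that])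
    then have "g (exp t *\<^sub>R m j 0) = exp t *\<^sub>R m j t"
      by (simp add: g_def m(2)[OF that] f(2)[OF that] sgn_scaleR)
    then show ?thesis using m(1)[OF that, of t] h(3)[of "K' (c j t)"] K'0[OF nz] by simp
  qed
  have "(h \<circ> g) ` R j = L j" if j: "j \<in> {1..\<nu>}" for j
  proof (intro equalityI subsetI)
    fix y assume "y \<in> (h \<circ> g) ` R j"
    then obtain t where "0 < t" "y = (h \<circ> g) (t *\<^sub>R m j 0)" by (auto simp: R_def)
    then show "y \<in> L j" using hg[OF j, of "ln t"] c(1)[OF j, of "ln t"] by simp
  next
    fix y assume "y \<in> L j"
    then have "y = c j (N y)" using N(2)[OF j] by (simp add: c_def)
    then show "y \<in> (h \<circ> g) ` R j" unfolding hg[OF j, symmetric]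
      by (rule image_eqI) (auto simp: R_def)
  qed
  moreover have "(h \<circ> g) 0 = 0" by (simp add: g_def h)
  ultimately have "frame \<nu> L = (h \<circ> g) ` frame \<nu> R"
    by (simp add: frame_def image_Un image_UN del: image_comp)
  moreover have "standard_frame \<nu> (frame \<nu> R)"
  proof -
    have ray: "open_ray (R j)" if "j \<in> {1..\<nu>}" for j
      unfolding open_ray_iff R_def using m(2)[OF that] by blast
    have inj: "inj_on R {1..\<nu>}"
    proof (rule inj_onI)
      fix i j assume ij: "i \<in> {1..\<nu>}" "j \<in> {1..\<nu>}" "R i = R j"
      have "m i 0 \<in> R i" by (auto simp: R_def intro!: exI[of _ "1::real"])
      then obtain t where t: "0 < t" "m i 0 = t *\<^sub>R m j 0" using ij by (auto simp: R_def)
      then have "norm (m i 0) = t * norm (m j 0)" by simp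
      then have "t = 1" using m(2)[OF ij(1)] m(2)[OF ij(2)] by simp
      then have "m i 0 = m j 0" using t by simp
      then show "i = j" using \<open>moving_points {1..\<nu>} m\<close> ij unfolding moving_points_def by blast
    qed
    show ?thesis unfolding standard_frame_def
      using arcs_of_frame_open_rays[OF ray inj] ray inj by blast
  qed
  ultimately show ?thesis unfolding tame_frame_def using H by blast
qed

subsection \<open>Cones over finite subsets of the sphere\<close>

text \<open>Standard frames are cones over finite sets of unit vectors, so counting rays becomes
  \<open>card\<close>. The apex is listed separately because \<open>sgn 0 = 0\<close> is not a unit
  vector.\<close>

definition cone_over :: "'a::real_normed_vector set \<Rightarrow> 'a set" where
  "cone_over \<Sigma> = {x. x = 0 \<or> sgn x \<in> \<Sigma>}"

lemma sgn_eq_unit_iff: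
  fixes x s :: "'a::real_normed_vector"
  assumes "norm s = 1"
  shows "sgn x = s \<longleftrightarrow> x \<noteq> 0 \<and> x = norm x *\<^sub>R s"
proof
  assume "sgn x = s"
  moreover from this have "x \<noteq> 0" using assms by auto
  ultimately show "x \<noteq> 0 \<and> x = norm x *\<^sub>R s" by (auto simp: sgn_div_norm)
next
  assume x: "x \<noteq> 0 \<and> x = norm x *\<^sub>R s"
  then have "sgn x = sgn (norm x *\<^sub>R s)" by metis
  also have "\<dots> = sgn s" using conjunct1[OF x] by (simp add: sgn_scaleR)
  also have "\<dots> = s" by (simp add: sgn_div_norm assms)
  finally show "sgn x = s" .
qed

lemma ray_eq_image:
  fixes s :: "'a::real_normed_vector"
  assumes "norm s = 1"
  shows "{x. sgn x = s} = (\<lambda>t. t *\<^sub>R s) ` {0<..}"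
proof (intro equalityI subsetI)
  fix x assume "x \<in> {x. sgn x = s}"
  then have "x \<noteq> 0" "x = norm x *\<^sub>R s" using sgn_eq_unit_iff[OF assms] by auto
  then show "x \<in> (\<lambda>t. t *\<^sub>R s) ` {0<..}" by (intro image_eqI) auto
qed (auto simp: sgn_scaleR sgn_div_norm assms)

text \<open>If the apex moved to \<open>p\<close>, then \<open>h\<close> would carry the disjoint
  open rays onto the cone without \<open>p\<close>. One ray is connected, while a single closed ray
  minus an inner point is not. With more rays, the cone without \<open>p\<close> is a union of two
  connected sets, which allows at most two directions.\<close>

lemma cone_over_apex_fixed:
  fixes \<Sigma> :: "'a::euclidean_space set"
  assumes \<Sigma>: "finite \<Sigma>" "\<Sigma> \<subseteq> sphere 0 1" "card \<Sigma> \<noteq> 2"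
    and h: "homeomorphism UNIV UNIV h h'" and inv: "h ` cone_over \<Sigma> = cone_over \<Sigma>"
  shows "h 0 = 0"
proof (rule ccontr)
  define p where "p = h 0"
  assume "h 0 \<noteq> 0"
  then have p: "p \<noteq> 0" "sgn p \<in> \<Sigma>" using inv by (auto simp: p_def cone_over_def)
  have unit: "norm s = 1" if "s \<in> \<Sigma>" for s using \<Sigma>(2) that by auto
  have h': "h' (h x) = x" "h (h' x) = x" for x
    using homeomorphism_apply1[OF h] homeomorphism_apply2[OF h] by auto
  define X where "X = cone_over \<Sigma> - {0}"
  have hX: "h ` X = cone_over \<Sigma> - {p}"
  proof -
    have "inj h" using h'(1) by (rule inj_on_inverseI)
    then show ?thesis by (simp add: X_def p_def image_set_diff inv)
  qed
  show False
  proof (cases "card \<Sigma> = 1")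
    case True
    then obtain s where s: "\<Sigma> = {s}" by (auto simp: card_1_singleton_iff)
    have "norm s = 1" "sgn p = s" using unit s p by auto
    have "X = {x. sgn x = s}" using \<open>norm s = 1\<close> by (auto simp: X_def cone_over_def s)
    then have "connected X"
      unfolding ray_eq_image[OF \<open>norm s = 1\<close>]
      by (auto intro!: connected_continuous_image continuous_intros)
    then have "connected (norm ` h ` X)"
      by (intro connected_continuous_image continuous_intros continuous_on_subset[OF homeomorphism_cont1[OF h]]) auto
    \<comment> \<open>\<open>0\<close> and \<open>2 *\<^sub>R p\<close> lie on opposite sides of
      \<open>p\<close>. The norm takes the value \<open>norm p\<close> in between, which on a single
      ray happens only at \<open>p\<close>.\<close>
    moreover have "0 \<in> h ` X" using p unfolding hX by (auto simp: cone_over_def)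
    then have "0 \<in> norm ` h ` X" by force
    moreover have "2 *\<^sub>R p \<noteq> p" using p by (simp add: scaleR_2)
    then have "2 *\<^sub>R p \<in> h ` X" using p unfolding hX by (auto simp: cone_over_def sgn_scaleR)
    then have "2 * norm p \<in> norm ` h ` X" by (rule image_eqI[rotated]) simp
    ultimately have "norm p \<in> norm ` h ` X"
      using connectedD_interval[of "norm ` h ` X" 0 "2 * norm p" "norm p"] by auto
    then obtain y where y: "y \<in> cone_over \<Sigma> - {p}" "norm y = norm p" unfolding hX by (metis imageE)
    then have "sgn y = s" using p by (auto simp: cone_over_def s)
    then show False using y \<open>sgn p = s\<close> by (metis DiffD2 \<open>norm s = 1\<close> sgn_eq_unit_iff singletonI)
  next
    case False
    \<comment> \<open>\<open>A\<close> is the part of the ray beyond \<open>p\<close>;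
      \<open>B\<close> is the rest without \<open>p\<close>, starlike about the apex.\<close>
    define A B where "A = {x. sgn x = sgn p \<and> norm p < norm x}"
      and "B = {x \<in> cone_over \<Sigma>. \<not> (sgn x = sgn p \<and> norm p \<le> norm x)}"
    have AB: "A \<union> B = cone_over \<Sigma> - {p}"
    proof -
      have "x = p" if "sgn x = sgn p" "norm x = norm p" for x
        using that p by (simp add: sgn_div_norm)
      then show ?thesis using p by (force simp: A_def B_def cone_over_def)
    qed
    have "A = (\<lambda>t. t *\<^sub>R sgn p) ` {norm p<..}"
    proof (intro equalityI subsetI)
      fix x assume "x \<in> A"
      then have "norm p < norm x" "x = norm x *\<^sub>R sgn p"
        using p by (auto simp: A_def sgn_eq_unit_iff norm_sgn)
      then show "x \<in> (\<lambda>t. t *\<^sub>R sgn p) ` {norm p<..}" by (intro image_eqI) auto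
    next
      fix x assume "x \<in> (\<lambda>t. t *\<^sub>R sgn p) ` {norm p<..}"
      then obtain t where t: "norm p < t" "x = t *\<^sub>R sgn p" by auto
      moreover have "0 < t" using t(1) norm_ge_zero[of p] by linarith
      moreover have "sgn (sgn p) = sgn p" using p by (simp add: sgn_div_norm[of "sgn p"] norm_sgn)
      ultimately show "x \<in> A" using p by (simp add: A_def sgn_scaleR norm_sgn)
    qed
    then have "connected A" by (auto intro!: connected_continuous_image continuous_intros)
    have "starlike B" unfolding starlike_def
    proof (intro bexI[of _ 0] ballI subsetI)
      show "0 \<in> B" using p by (simp add: B_def cone_over_def)
      fix x y assume "x \<in> B" "y \<in> closed_segment 0 x"
      then obtain u where u: "0 \<le> u" "u \<le> 1" "y = u *\<^sub>R x" by (auto simp: closed_segment_def)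
      show "y \<in> B"
      proof (cases "y = 0")
        case True
        then show ?thesis using \<open>0 \<in> B\<close> by simp
      next
        case False
        then have "sgn y = sgn x" using u by (simp add: sgn_scaleR)
        moreover have "norm y \<le> norm x" using u by (simp add: mult_left_le_one_le)
        ultimately show ?thesis using \<open>x \<in> B\<close> False by (auto simp: B_def cone_over_def)
      qed
    qed
    then have "connected B" by (rule starlike_imp_connected)
    \<comment> \<open>The direction of \<open>h' x\<close> varies continuously in a finite set, so
      it is constant on connected sets.\<close>
    have single: "\<exists>a. \<forall>x\<in>C. sgn (h' x) = a" if "connected C" "C \<subseteq> cone_over \<Sigma> - {p}" for C
    proof -
      have CX: "h' ` C \<subseteq> X" using that(2) h'(1) unfolding hX[symmetric] by auto
      have "connected (h' ` C)"
        using that(1) by (intro connected_continuous_image continuous_on_subset[OF homeomorphism_cont2[OF h]]) auto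
      moreover have "continuous_on (h' ` C) sgn"
        unfolding sgn_div_norm[abs_def] using CX by (intro continuous_intros) (auto simp: X_def)
      ultimately have "connected (sgn ` h' ` C)" by (rule connected_continuous_image[rotated])
      moreover have "finite (sgn ` h' ` C)"
        using CX by (intro finite_subset[OF _ \<Sigma>(1)]) (auto simp: X_def cone_over_def)
      ultimately have "sgn ` h' ` C = {} \<or> (\<exists>a. sgn ` h' ` C = {a})"
        using connected_finite_iff_sing by blast
      then show ?thesis by blast
    qed
    obtain a b where ab: "\<And>x. x \<in> A \<Longrightarrow> sgn (h' x) = a" "\<And>x. x \<in> B \<Longrightarrow> sgn (h' x) = b"
      using single[OF \<open>connected A\<close>] single[OF \<open>connected B\<close>] AB by (metis Un_upper1 Un_upper2)
    have "\<Sigma> \<subseteq> {a, b}"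
    proof
      fix s assume "s \<in> \<Sigma>"
      then have s: "norm s = 1" "sgn s = s" using unit by (auto simp: sgn_div_norm)
      then have "s \<in> X" using \<open>s \<in> \<Sigma>\<close> by (auto simp: X_def cone_over_def)
      then have "h s \<in> A \<union> B" using hX AB by blast
      then show "s \<in> {a, b}" using ab[of "h s"] s h'(1) by auto
    qed
    then have "card \<Sigma> \<le> card {a, b}" by (intro card_mono) auto
    also have "\<dots> \<le> 2" by (simp add: card_insert_if)
    finally have "card \<Sigma> = 0" using False \<Sigma>(3) by linarith
    then show False using \<Sigma>(1) p by simp
  qed
qed

text \<open>Two rays form a bent line without a topologically distinguished point; this lemma moves
  the apex wherever it is wanted.\<close>

lemma cone_over_pair_homogeneous:
  fixes a b p :: "'a::euclidean_space"
  assumes ab: "norm a = 1" "norm b = 1" "a \<noteq> b" and p: "p \<in> cone_over {a, b}"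
  shows "\<exists>T T'. homeomorphism UNIV UNIV T T' \<and> T ` cone_over {a, b} = cone_over {a, b} \<and> T 0 = p"
proof -
  \<comment> \<open>\<open>f\<close> parametrises the bent line, with \<open>a\<close> in the
    positive and \<open>b\<close> in the negative direction. The functional \<open>\<pi>\<close>
    takes the values 1 at \<open>a\<close> and -1 at \<open>b\<close>, so it is a linear left
    inverse of \<open>f\<close>.\<close>
  define f where "f u = max 0 u *\<^sub>R a + max 0 (- u) *\<^sub>R b" for u :: real
  define c where "c = 1 - a \<bullet> b"
  define \<pi> where "\<pi> x = (x \<bullet> (a - b)) / c" for x
  have aa: "a \<bullet> a = 1" "b \<bullet> b = 1" using ab by (simp_all add: dot_square_norm)
  have "0 < (a - b) \<bullet> (a - b)" using ab by simp
  then have c: "0 < c" by (simp add: c_def inner_diff aa inner_commute)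
  have pf: "\<pi> (f u) = u" for u
    using c by (cases "0 \<le> u") (simp_all add: \<pi>_def f_def inner_add_left inner_diff_right aa inner_commute c_def max_def field_simps)
  have p_add: "\<pi> (x + y) = \<pi> x + \<pi> y" "\<pi> (x - y) = \<pi> x - \<pi> y" for x y
    by (simp_all add: \<pi>_def inner_add_left inner_diff_left add_divide_distrib diff_divide_distrib)
  have f0: "f 0 = 0" by (simp add: f_def)
  have cont: "continuous_on UNIV f" "continuous_on UNIV \<pi>"
    unfolding f_def \<pi>_def using c by (auto intro!: continuous_intros)
  have range: "range f = cone_over {a, b}"
  proof (intro equalityI subsetI)
    fix x assume "x \<in> range f"
    then obtain u where "x = f u" by blast
    then show "x \<in> cone_over {a, b}"
      using ab by (cases u "0::real" rule: linorder_cases)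
        (simp_all add: f_def cone_over_def sgn_scaleR sgn_div_norm max_def)
  next
    fix x assume "x \<in> cone_over {a, b}"
    then consider "x = 0" | "sgn x = a" | "sgn x = b" by (auto simp: cone_over_def)
    then have "x = f 0 \<or> x = f (norm x) \<or> x = f (- norm x)"
      by cases (auto simp: f_def sgn_eq_unit_iff ab)
    then show "x \<in> range f" by blast
  qed
  \<comment> \<open>Since \<open>\<pi>\<close> inverts \<open>f\<close> and is additive, \<open>T d\<close> raises \<open>\<pi>\<close> by \<open>d\<close>, whence \<open>T (- d)\<close> inverts it.\<close>
  define T where "T d x = x + f (\<pi> x + d) - f (\<pi> x)" for d x
  have pT: "\<pi> (T d x) = \<pi> x + d" for d x by (simp add: T_def p_add pf)
  have inv: "T (- d) (T d x) = x" for d x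
    unfolding T_def[of "- d"] pT by (simp add: T_def)
  have Tf: "T d (f u) = f (u + d)" for d u by (simp add: T_def pf)
  have contT: "continuous_on UNIV (T d)" for d
    unfolding T_def by (intro continuous_intros continuous_on_compose2[OF cont(1)] cont(2)) auto
  obtain d where d: "p = f d" using p range by auto
  have "homeomorphism UNIV UNIV (T d) (T (- d))"
    using contT inv[of d] inv[of "- d"] by (intro homeomorphismI) auto
  moreover have "T d ` range f = range f"
  proof (intro equalityI subsetI)
    fix x assume "x \<in> range f"
    then obtain u where "x = T d (f (u - d))" by (auto simp: Tf)
    then show "x \<in> T d ` range f" by blast
  qed (auto simp: Tf)
  moreover have "T d 0 = p" using Tf[of d 0] by (simp add: f0 d)
  ultimately show ?thesis unfolding range by blast
qed

subsection \<open>From tameness to a transverse foliation\<close>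

text \<open>Arcs are not assumed connected, so the argument starts from the rays: the arcs cut each
  ray into open pieces, hence each ray image lies in one arc. Every arc is nonempty and there are as
  many rays as arcs, so each arc receives exactly one ray.\<close>

lemma arcs_eq_images_of_rays:
  fixes h :: "real^3 \<Rightarrow> real^3"
  assumes L: "arcs_of_frame \<nu> L" and \<Sigma>: "finite \<Sigma>" "\<Sigma> \<subseteq> sphere 0 1" "card \<Sigma> = \<nu>"
    and h: "homeomorphism UNIV UNIV h h'" "h 0 = 0" and eq: "frame \<nu> L = h ` cone_over \<Sigma>"
    and j: "j \<in> {1..\<nu>}"
  shows "\<exists>s\<in>\<Sigma>. L j = h ` {x. sgn x = s}"
proof -
  have h': "h' (h x) = x" "h (h' x) = x" for x
    using homeomorphism_apply1[OF h(1)] homeomorphism_apply2[OF h(1)] by auto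
  have sub: "one_dim_submanifold (UNIV - {0}) (L j)" "L j \<subseteq> UNIV - {0}" "L j \<noteq> {}" if "j \<in> {1..\<nu>}" for j
  proof -
    have arc: "infinite_arc (L j)" using L that by (simp add: arcs_of_frame_def)
    then show "one_dim_submanifold (UNIV - {0}) (L j)" "L j \<subseteq> UNIV - {0}"
      by (auto simp: infinite_arc_def one_dim_submanifold_def)
    show "L j \<noteq> {}" using arc unfolding infinite_arc_def by (metis image_empty empty_not_UNIV)
  qed
  have disj: "i = j" if "x \<in> L i" "x \<in> L j" "i \<in> {1..\<nu>}" "j \<in> {1..\<nu>}" for i j x
    using L that unfolding arcs_of_frame_def disjoint_family_on_def by blast
  have nz: "h' y \<noteq> 0" if "y \<in> L j" "j \<in> {1..\<nu>}" for y j
    using that sub(2)[OF that(2)] h'(2)[of y] h(2) by auto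
  have dir: "sgn (h' y) \<in> \<Sigma>" if "y \<in> L j" "j \<in> {1..\<nu>}" for y j
  proof -
    have "y \<in> h ` cone_over \<Sigma>" unfolding eq[symmetric] frame_def using that by blast
    then show ?thesis using nz[OF that] h'(1) by (auto simp: cone_over_def)
  qed
  define W where "W s j = {y \<in> L j. sgn (h' y) = s}" for s j
  define f where "f y = norm (h' y)" for y
  have openW: "open (f ` W s j)" if s: "s \<in> \<Sigma>" and j: "j \<in> {1..\<nu>}" for s j
  proof (rule open_image_one_dim_submanifold[OF sub(1)[OF j]])
    have cont: "continuous_on (L j) h'" using homeomorphism_cont2[OF h(1)] by (rule continuous_on_subset) simp
    \<comment> \<open>As \<open>\<Sigma>\<close> is finite, avoiding all other directions is an open
      condition.\<close>
    have "W s j = L j \<inter> (\<lambda>y. sgn (h' y)) -` (- (\<Sigma> - {s}))"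
      using dir[OF _ j] s by (auto simp: W_def)
    moreover have "continuous_on (L j) (\<lambda>y. sgn (h' y))"
      unfolding sgn_div_norm using nz[OF _ j] by (intro continuous_intros cont) auto
    moreover have "open (- (\<Sigma> - {s}))" using \<Sigma>(1) by (intro open_Compl finite_imp_closed) simp
    ultimately show "openin (top_of_set (L j)) (W s j)"
      using continuous_openin_preimage_gen by metis
    show "continuous_on (W s j) f"
      unfolding f_def by (intro continuous_intros continuous_on_subset[OF cont]) (auto simp: W_def)
    show "inj_on f (W s j)"
    proof (rule inj_onI)
      fix x y assume "x \<in> W s j" "y \<in> W s j" "f x = f y"
      then have "sgn (h' x) = sgn (h' y)" "norm (h' x) = norm (h' y)" "h' y \<noteq> 0"
        using nz[OF _ j] by (auto simp: W_def f_def)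
      then have "h' x = h' y" by (simp add: sgn_div_norm)
      then show "x = y" by (metis h'(2))
    qed
  qed
  have "\<exists>j\<in>{1..\<nu>}. h ` {x. sgn x = s} \<subseteq> L j" if s: "s \<in> \<Sigma>" for s
  proof -
    have s1: "norm s = 1" "sgn s = s" using s \<Sigma>(2) by (auto simp: sgn_div_norm)
    have cover: "\<exists>j\<in>{1..\<nu>}. h x \<in> L j" if "sgn x = s" for x
    proof -
      have "x \<noteq> 0" using that s1 by auto
      then have "h x \<noteq> 0" using h'(1) h(2) by metis
      moreover have "h x \<in> frame \<nu> L" unfolding eq using that s by (auto simp: cone_over_def)
      ultimately show ?thesis by (auto simp: frame_def)
    qed
    obtain i where i: "i \<in> {1..\<nu>}" "h s \<in> L i" using cover[OF s1(2)] by blast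
    \<comment> \<open>\<open>U\<close> holds the parameters at which the ray image lies in
      \<open>L i\<close>, \<open>V\<close> those of the other arcs; connectedness of the half-line
      leaves only \<open>U\<close>.\<close>
    define U V where "U = f ` W s i" and "V = (\<Union>j\<in>{1..\<nu>} - {i}. f ` W s j)"
    have fW: "h (t *\<^sub>R s) \<in> L j" if t: "t \<in> f ` W s j" for t j
    proof -
      obtain y where "y \<in> W s j" "t = f y" using t by blast
      then have "h' y = t *\<^sub>R s" using s1 by (auto simp: W_def f_def sgn_eq_unit_iff)
      then show ?thesis using \<open>y \<in> W s j\<close> h'(2)[of y] by (auto simp: W_def)
    qed
    have Wf: "t \<in> f ` W s j" if "0 < t" "h (t *\<^sub>R s) \<in> L j" for t j
      using that s1 by (intro image_eqI[of _ _ "h (t *\<^sub>R s)"]) (auto simp: W_def f_def h' sgn_scaleR)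
    have "U \<inter> V \<inter> {0<..} = {}"
    proof -
      have False if "t \<in> f ` W s i" "t \<in> f ` W s j" "j \<in> {1..\<nu>} - {i}" for t j
        using disj[OF fW[OF that(1)] fW[OF that(2)]] i(1) that(3) by blast
      then show ?thesis unfolding U_def V_def by blast
    qed
    moreover have "{0<..} \<subseteq> U \<union> V"
    proof
      fix t :: real assume "t \<in> {0<..}"
      then obtain j where "j \<in> {1..\<nu>}" "h (t *\<^sub>R s) \<in> L j"
        using cover[of "t *\<^sub>R s"] s1 by (auto simp: sgn_scaleR)
      then show "t \<in> U \<union> V" using Wf[of t j] \<open>t \<in> {0<..}\<close> by (cases "j = i") (auto simp: U_def V_def)
    qed
    moreover have "open U" "open V" using openW[OF s] i(1) by (auto simp: U_def V_def)
    ultimately have "U \<inter> {0<..} = {} \<or> V \<inter> {0<..} = {}"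
      by (intro connectedD) auto
    moreover have "1 \<in> U" using Wf[of 1 i] i by (simp add: U_def)
    ultimately have "{0<..} \<subseteq> U" using \<open>{0<..} \<subseteq> U \<union> V\<close> zero_less_one by blast
    then have "h ` {x. sgn x = s} \<subseteq> L i"
      unfolding ray_eq_image[OF s1(1)] using fW by (auto simp: U_def)
    then show ?thesis using i(1) by blast
  qed
  then obtain \<tau> where \<tau>: "\<And>s. s \<in> \<Sigma> \<Longrightarrow> \<tau> s \<in> {1..\<nu>}" "\<And>s. s \<in> \<Sigma> \<Longrightarrow> h ` {x. sgn x = s} \<subseteq> L (\<tau> s)"
    by metis
  have \<tau>_dir: "\<tau> (sgn (h' y)) = i" if "y \<in> L i" "i \<in> {1..\<nu>}" for y i
  proof -
    have "y \<in> L (\<tau> (sgn (h' y)))" using \<tau>(2)[OF dir[OF that]] h'(2)[of y] by force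
    then show ?thesis using disj that \<tau>(1)[OF dir[OF that]] by blast
  qed
  \<comment> \<open>A surjection between finite sets of the same size is injective.\<close>
  have "\<tau> ` \<Sigma> = {1..\<nu>}"
  proof (intro equalityI subsetI)
    fix i assume i: "i \<in> {1..\<nu>}"
    then obtain y where "y \<in> L i" using sub(3) by blast
    then show "i \<in> \<tau> ` \<Sigma>" using \<tau>_dir[OF _ i] dir[OF _ i] by force
  qed (use \<tau>(1) in auto)
  then have "inj_on \<tau> \<Sigma>" using \<Sigma> by (intro eq_card_imp_inj_on) auto
  have "j \<in> \<tau> ` \<Sigma>" unfolding \<open>\<tau> ` \<Sigma> = {1..\<nu>}\<close> by (rule j)
  then obtain s where s: "s \<in> \<Sigma>" "\<tau> s = j" by (metis imageE)
  have "L j \<subseteq> h ` {x. sgn x = s}"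
  proof
    fix y assume y: "y \<in> L j"
    have "sgn (h' y) = s"
      using \<open>inj_on \<tau> \<Sigma>\<close> dir[OF y j] \<tau>_dir[OF y j] s by (auto dest: inj_onD)
    then show "y \<in> h ` {x. sgn x = s}" using h'(2)[of y] by force
  qed
  then show ?thesis using s \<tau>(2) by blast
qed

lemma standard_frame_imp_cone_over:
  assumes "standard_frame \<nu> S"
  obtains \<Sigma> where "finite \<Sigma>" "\<Sigma> \<subseteq> sphere 0 1" "card \<Sigma> = \<nu>" "S = cone_over \<Sigma>"
proof -
  obtain R where R: "\<And>j. j \<in> {1..\<nu>} \<Longrightarrow> open_ray (R j)" "inj_on R {1..\<nu>}" "S = frame \<nu> R"
    using assms unfolding standard_frame_def by blast
  have "\<forall>j\<in>{1..\<nu>}. \<exists>s. norm s = 1 \<and> R j = {x. sgn x = s}"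
  proof
    fix j assume "j \<in> {1..\<nu>}"
    then obtain s where s: "norm s = 1" "R j = {t *\<^sub>R s |t. t > 0}" using R(1) open_ray_iff by blast
    then have "R j = {x. sgn x = s}" unfolding ray_eq_image[OF s(1)] by auto
    with s(1) show "\<exists>s. norm s = 1 \<and> R j = {x. sgn x = s}" by blast
  qed
  then obtain s where s: "\<And>j. j \<in> {1..\<nu>} \<Longrightarrow> norm (s j) = 1" "\<And>j. j \<in> {1..\<nu>} \<Longrightarrow> R j = {x. sgn x = s j}"
    by metis
  have "inj_on s {1..\<nu>}"
  proof (rule inj_onI)
    fix i j assume "i \<in> {1..\<nu>}" "j \<in> {1..\<nu>}" "s i = s j"
    then show "i = j" using s(2)[of i] s(2)[of j] by (intro inj_onD[OF R(2)]) auto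
  qed
  then have "card (s ` {1..\<nu>}) = \<nu>" by (simp add: card_image)
  moreover have "S = cone_over (s ` {1..\<nu>})"
  proof -
    have "(\<Union>j\<in>{1..\<nu>}. R j) = (\<Union>j\<in>{1..\<nu>}. {x. sgn x = s j})" using s(2) by (intro SUP_cong) auto
    then show ?thesis unfolding R(3) frame_def cone_over_def by auto
  qed
  ultimately show thesis using s(1) by (intro that[of "s ` {1..\<nu>}"]) auto
qed

text \<open>For two rays, the apex is first slid to the point that \<open>h\<close> sends to the
  origin. Otherwise, doubling conjugated by \<open>h\<close> preserves the cone and so fixes its
  apex; hence \<open>h 0\<close> is fixed by doubling, whose only fixed point is the origin.\<close>

lemma frame_homeomorphism_fixing_zero:
  fixes h :: "real^3 \<Rightarrow> real^3"
  assumes L: "arcs_of_frame \<nu> L" and \<Sigma>: "finite \<Sigma>" "\<Sigma> \<subseteq> sphere 0 1"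
    and h: "homeomorphism UNIV UNIV h h'" and eq: "frame \<nu> L = h ` cone_over \<Sigma>"
  shows "\<exists>g g'. homeomorphism UNIV UNIV g g' \<and> frame \<nu> L = g ` cone_over \<Sigma> \<and> g 0 = 0"
proof (cases "card \<Sigma> = 2")
  case True
  then obtain a b where ab: "\<Sigma> = {a, b}" "a \<noteq> b" by (auto simp: card_2_iff)
  have "0 \<in> h ` cone_over \<Sigma>" unfolding eq[symmetric] by (simp add: frame_def)
  then obtain p where p: "p \<in> cone_over {a, b}" "h p = 0" unfolding ab by auto
  obtain T T' where T: "homeomorphism UNIV UNIV T T'" "T ` cone_over \<Sigma> = cone_over \<Sigma>" "T 0 = p"
    using cone_over_pair_homogeneous[OF _ _ ab(2) p(1)] \<Sigma>(2) unfolding ab by auto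
  have "frame \<nu> L = (h \<circ> T) ` cone_over \<Sigma>" unfolding image_comp[symmetric] T(2) by (rule eq)
  then show ?thesis
    using homeomorphism_compose[OF T(1) h] p(2) T(3) by (intro exI[of _ "h \<circ> T"] exI[of _ "T' \<circ> h'"]) simp
next
  case False
  have h': "h' (h x) = x" "h (h' x) = x" for x
    using homeomorphism_apply1[OF h] homeomorphism_apply2[OF h] by auto
  have hd: "homeomorphism UNIV UNIV doubling (\<lambda>x. x /\<^sub>R 2)"
    by (rule homeomorphismI) (auto simp: doubling_def intro!: continuous_intros)
  have "homeomorphism UNIV UNIV h' h" using h by (rule homeomorphism_symD)
  note hom = homeomorphism_compose[OF homeomorphism_compose[OF h hd] this]
  have "doubling ` frame \<nu> L = frame \<nu> L"
    using L by (simp add: frame_def arcs_of_frame_def image_Un image_UN doubling_def)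
  then have "(h' \<circ> (doubling \<circ> h)) ` cone_over \<Sigma> = h' ` h ` cone_over \<Sigma>"
    unfolding image_comp[symmetric] eq[symmetric] by simp
  also have "\<dots> = cone_over \<Sigma>" by (simp add: image_image h')
  finally have "(h' \<circ> (doubling \<circ> h)) 0 = 0"
    by (rule cone_over_apex_fixed[OF \<Sigma> False hom])
  then have "h (h' (doubling (h 0))) = h 0" by simp
  then have "h 0 = 0" by (simp add: h' doubling_def scaleR_2)
  then show ?thesis using h eq by blast
qed

lemma transverse_foliation_if_tame_frame:
  assumes L: "arcs_of_frame \<nu> L" and tame: "tame_frame \<nu> (frame \<nu> L)"
  shows "\<exists>G G'. homeomorphism (UNIV - {0 :: real^3}) (UNIV - {0}) G G' \<and>
       (\<forall>t>0. \<forall>j\<in>{1..\<nu>}. \<exists>p. G ` sphere 0 t \<inter> L j = {p})"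
proof -
  obtain h0 h0' S where 0: "homeomorphism UNIV UNIV h0 h0'" "standard_frame \<nu> S" "frame \<nu> L = h0 ` S"
    using tame unfolding tame_frame_def by blast
  obtain \<Sigma> where \<Sigma>: "finite \<Sigma>" "\<Sigma> \<subseteq> sphere 0 1" "card \<Sigma> = \<nu>" "S = cone_over \<Sigma>"
    using standard_frame_imp_cone_over[OF 0(2)] .
  obtain h h' where h: "homeomorphism UNIV UNIV h h'" "frame \<nu> L = h ` cone_over \<Sigma>" "h 0 = 0"
    using frame_homeomorphism_fixing_zero[OF L \<Sigma>(1,2) 0(1)] 0(3) \<Sigma>(4) by blast
  have inj: "inj h" using homeomorphism_apply1[OF h(1)] by (metis UNIV_I injI)
  have "h ` (UNIV - {0}) = UNIV - {0}"
    using inj h(3) homeomorphism_image1[OF h(1)] by (simp add: image_set_diff)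
  then have "homeomorphism (UNIV - {0}) (UNIV - {0}) h h'"
    using h(1) by (intro homeomorphism_of_subsets[OF h(1)]) auto
  moreover have "\<exists>p. h ` sphere 0 t \<inter> L j = {p}" if "0 < t" and j: "j \<in> {1..\<nu>}" for t j
  proof -
    obtain s where s: "s \<in> \<Sigma>" "L j = h ` {x. sgn x = s}"
      using arcs_eq_images_of_rays[OF L \<Sigma>(1-3) h(1,3,2) j] by blast
    have "norm s = 1" using s(1) \<Sigma>(2) by auto
    then have "sphere 0 t \<inter> {x. sgn x = s} = {t *\<^sub>R s}"
      using \<open>0 < t\<close> by (auto simp: ray_eq_image)
    then show ?thesis unfolding s(2) image_Int[OF inj, symmetric] by auto
  qed
  ultimately show ?thesis by blast
qed

theorem theorem1:
  fixes \<nu> :: nat and L :: "nat \<Rightarrow> (real^3) set"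
  assumes "arcs_of_frame \<nu> L"
  shows "tame_frame \<nu> (frame \<nu> L) \<longleftrightarrow>
    (\<exists>G G'. homeomorphism (UNIV - {0 :: real^3}) (UNIV - {0}) G G' \<and>
       (\<forall>t>0. \<forall>j\<in>{1..\<nu>}. \<exists>p. G ` sphere 0 t \<inter> L j = {p}))"
proof
  assume "tame_frame \<nu> (frame \<nu> L)"
  with assms show "\<exists>G G'. homeomorphism (UNIV - {0 :: real^3}) (UNIV - {0}) G G' \<and>
       (\<forall>t>0. \<forall>j\<in>{1..\<nu>}. \<exists>p. G ` sphere 0 t \<inter> L j = {p})"
    by (rule transverse_foliation_if_tame_frame)
next
  assume "\<exists>G G'. homeomorphism (UNIV - {0 :: real^3}) (UNIV - {0}) G G' \<and>
       (\<forall>t>0. \<forall>j\<in>{1..\<nu>}. \<exists>p. G ` sphere 0 t \<inter> L j = {p})"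
  then obtain G G' :: "real^3 \<Rightarrow> real^3" where
    "homeomorphism (UNIV - {0}) (UNIV - {0}) G G'"
    "\<forall>t>0. \<forall>j\<in>{1..\<nu>}. \<exists>p. G ` sphere 0 t \<inter> L j = {p}" by blast
  then show "tame_frame \<nu> (frame \<nu> L)"
    by (intro tame_frame_if_transverse_foliation[OF assms]) auto
qed

end
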